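(* Let $R\ge 2$ be an integer. Then $$\nu^*(R)\ \le\ e\,(R\log R+\log R+\log\log R+4),$$ where $\log$ is the natural logarithm and $\nu^*(R)$ is the asymptotic worst-case density of normal binary covering codes of radius $R$ (defined in the context).
   Context: Let $Q_n=\{0,1\}^n$ with addition mod 2 coordinatewise. The Hamming distance $d(x,y)$ is the number of coordinates in which $x,y\in Q_n$ differ; for $Y\subseteq Q_n$, $d(x,Y)=\min\{d(x,y):y\in Y\}$, with $d(x,\emptyset)=\infty$. The covering radius of $\mathcal C\subseteq Q_n$ is the smallest integer $R\ge 0$ such that every $x\in Q_n$ satisfies $d(x,\mathcal C)\le R$; an $(n,R)$-code is a set $\mathcal C\subseteq Q_n$ with covering radius $R$. For $i\in\{1,\dots,n\}$ and $b\in\{0,1\}$ put $\mathcal C^{(i)}_b=\{c\in\mathcal C: c_i=b\}$. The norm of $\mathcal C$ with respect to coordinate $i$ is $N^{(i)}=\max_{x\in Q_n}\{d(x,\mathcal C^{(i)}_0)+d(x,\mathcal C^{(i)}_1)\}$, and the minimum norm is $N_{\min}(\mathcal C)=\min_{1\le i\le n}N^{(i)}$. A code with covering radius $R$ is normal if $N_{\min}(\mathcal C)\le 2R+1$ (then necessarily $N_{\min}(\mathcal C)\in\{2R,2R+1\}$). $K_\nu(n,R)$ is the minimum size of a normal $(n,R)$-code, $\binom{n}{\le R}=\sum_{i=0}^R\binom ni$, $\nu(n,R)=\dfrac{K_\nu(n,R)}{2^n/\binom{n}{\le R}}$, and $\nu^*(R)=\limsup_{n\to\infty}\nu(n,R)$.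 *)

theory Defs
  imports
    Complex_Main
    "HOL-Library.FuncSet"
    "HOL-Library.Z2"
    "HOL-Library.Extended_Nat"
    "HOL-Library.Extended_Real"
    "HOL-Library.Liminf_Limsup"
begin

text \<open>Words are extensional functions on \<open>{1..n}\<close> with values in the two-element field \<open>bit\<close>.\<close>

definition cube :: "nat \<Rightarrow> (nat \<Rightarrow> bit) set" where
  "cube n = {1..n} \<rightarrow>\<^sub>E UNIV"

definition hamming :: "nat \<Rightarrow> (nat \<Rightarrow> bit) \<Rightarrow> (nat \<Rightarrow> bit) \<Rightarrow> nat" where
  "hamming n x y = card {i \<in> {1..n}. x i \<noteq> y i}"

text \<open>Infima in \<^typ>\<open>enat\<close> over nonempty sets are attained, and the infimum over the empty
  set is \<open>\<infinity>\<close>.\<close>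

definition set_hamming :: "nat \<Rightarrow> (nat \<Rightarrow> bit) \<Rightarrow> (nat \<Rightarrow> bit) set \<Rightarrow> enat" where
  "set_hamming n x Y = (INF y\<in>Y. enat (hamming n x y))"

text \<open>The value is \<open>\<infinity>\<close> exactly when no natural number works, i.e. for the empty code.\<close>

definition covering_radius :: "nat \<Rightarrow> (nat \<Rightarrow> bit) set \<Rightarrow> enat" where
  "covering_radius n C = (LEAST r. \<forall>x\<in>cube n. set_hamming n x C \<le> r)"

definition is_code :: "nat \<Rightarrow> nat \<Rightarrow> (nat \<Rightarrow> bit) set \<Rightarrow> bool" where
  "is_code n R C \<longleftrightarrow> C \<subseteq> cube n \<and> covering_radius n C = enat R"

definition subcode :: "(nat \<Rightarrow> bit) set \<Rightarrow> nat \<Rightarrow> bit \<Rightarrow> (nat \<Rightarrow> bit) set" where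
  "subcode C i b = {c \<in> C. c i = b}"

definition code_norm :: "nat \<Rightarrow> (nat \<Rightarrow> bit) set \<Rightarrow> nat \<Rightarrow> enat" where
  "code_norm n C i =
     (MAX x\<in>cube n. set_hamming n x (subcode C i 0) + set_hamming n x (subcode C i 1))"

definition min_norm :: "nat \<Rightarrow> (nat \<Rightarrow> bit) set \<Rightarrow> enat" where
  "min_norm n C = (INF i\<in>{1..n}. code_norm n C i)"

definition is_normal_code :: "nat \<Rightarrow> nat \<Rightarrow> (nat \<Rightarrow> bit) set \<Rightarrow> bool" where
  "is_normal_code n R C \<longleftrightarrow> is_code n R C \<and> min_norm n C \<le> enat (2 * R + 1)"

text \<open>If there is no normal code with these parameters (which only happens for finitely many
  \<open>n\<close>, given \<open>R\<close>), the minimum size is \<open>\<infinity>\<close>.\<close>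

definition K_normal :: "nat \<Rightarrow> nat \<Rightarrow> enat" where
  "K_normal n R = (INF C\<in>{C. is_normal_code n R C}. enat (card C))"

definition binomial_le :: "nat \<Rightarrow> nat \<Rightarrow> nat" where
  "binomial_le n R = (\<Sum>i=0..R. n choose i)"

definition normal_density :: "nat \<Rightarrow> nat \<Rightarrow> ereal" where
  "normal_density n R = ereal_of_enat (K_normal n R) / ereal (2 ^ n / real (binomial_le n R))"

definition normal_density_limsup :: "nat \<Rightarrow> ereal" where
  "normal_density_limsup R = limsup (\<lambda>n. normal_density n R)"

end

theory Submission
  imports Defs "HOL-Number_Theory.Pocklington"
begin

text \<open>
  Normality costs nothing in the limit. If \<open>C\<close> is a code of length \<open>m\<close> and radius \<open>R\<close>, append a
  free bit: in the code \<open>C \<times> {0, 1}\<close> the two subcodes for the last coordinate are copies of \<open>C\<close>,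
  one of them agrees with a given word in that coordinate and the other does not, so the two
  distances add up to at most \<open>R + (R + 1)\<close>. Passing from length \<open>m\<close> to \<open>m + 1\<close> changes the volume
  of the ball by a factor tending to 1, hence the density is asymptotically that of \<open>C\<close>
  (\<open>normal_density_le\<close>). A code of bounded density and large length is too small to have radius
  \<open>R - 1\<close>, so its radius is exactly \<open>R\<close>. It remains to bound the density \<open>g N\<close> of the best
  covering codes of radius \<open>R\<close> and length \<open>N\<close>, which is done by a recursion for \<open>g\<close>.

  Split \<open>N = m + n\<close> with \<open>n = N div R\<close>. Choose greedily about \<open>\<delta> 2^m / V\<close> words of length \<open>m\<close>, where
  \<open>V\<close> is the volume of a ball of radius \<open>R - 1\<close>. All words except a set \<open>U\<close> of proportion at most
  \<open>exp (- \<delta>)\<close> are then within \<open>R - 1\<close> of a chosen word (\<open>greedy_partial_code\<close>). Multiply the chosen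
  words by an optimal code of radius 1 and length \<open>n\<close>, and the exceptional set \<open>U\<close> by an optimal
  code of radius \<open>R\<close> and length \<open>n\<close> (\<open>cov_num_partial_sum\<close>). With codes of radius 1 of density
  nearly 1 this gives, up to factors tending to 1,
  \<open>g N \<le> \<delta> (R / (R - 1))^(R - 1) + exp (- \<delta>) R^R g (N div R)\<close>.
  The first coefficient is at most \<open>e \<delta>\<close>. Put \<open>L = R log R\<close> and \<open>\<delta> = L + log L + 1\<close>; then the factor
  of the recursive term is \<open>1 / (e L) < 1\<close>, and the fixed point \<open>e \<delta> / (1 - 1 / (e L))\<close> of the
  recursion is below \<open>e (\<delta> + 3) = e (R log R + log R + log log R + 4)\<close>, with room to spare for all
  the error terms (\<open>cov_density_bound\<close>).

  The recursion needs, for every large length, a code of radius 1 whose density is close to 1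
  (\<open>radius_one_density\<close>; this is a theorem of Kabatyanskii and Panchenko). Hamming codes provide it
  only for the lengths \<open>2^b - 1\<close>, and doubling \<open>n \<mapsto> 2 n + 1\<close> (\<open>cov_num_double\<close>) preserves the density
  but does not leave these lengths. Codes over an odd group supply the missing lengths. Let
  \<open>N = 2^b - 1\<close> with \<open>b\<close> prime. Every prime factor of \<open>N\<close> exceeds \<open>b\<close>, so almost all residues modulo
  \<open>N\<close> are units, and the group \<open>(\<int> / N)^m\<close> is a union of little more than \<open>N^(m - 1)\<close> cyclic subgroups.
  A Hamming code of length \<open>N\<close> has \<open>N + 1\<close> cosets, each of covering radius 1; merging two of them
  lets at most one bit flip in a block of length \<open>N\<close> realise any prescribed residue modulo \<open>N\<close>. One block
  for each cyclic subgroup then yields a code of index \<open>N^m\<close>, radius 1 and length about \<open>N^m\<close>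
  (\<open>cov_num_cyclic\<close>). As \<open>N\<close> is slightly smaller than a power of 2, the numbers \<open>2^j N^m\<close> come close to
  every large number (\<open>products_of_powers_dense\<close>), and so do the lengths reached in this way.
\<close>

section \<open>Covering codes as families of sets\<close>

text \<open>Words are modelled as subsets of a coordinate set \<open>I\<close> (the positions of the ones), so that the
  Hamming distance is the size of the symmetric difference and products of codes live on disjoint
  unions of coordinate sets. Coordinates of any type are allowed, because the constructions below
  use structured coordinate sets.\<close>

definition near :: "nat \<Rightarrow> 'a set set \<Rightarrow> 'a set \<Rightarrow> bool" where
  "near r C x \<longleftrightarrow> (\<exists>c\<in>C. card (sym_diff x c) \<le> r)"

definition covers :: "'a set \<Rightarrow> nat \<Rightarrow> 'a set set \<Rightarrow> bool" where
  "covers I r C \<longleftrightarrow> C \<subseteq> Pow I \<and> (\<forall>x\<subseteq>I. near r C x)"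

definition cov_num :: "nat \<Rightarrow> nat \<Rightarrow> nat" where
  "cov_num n r = (LEAST m. \<exists>C. covers {..<n} r C \<and> card C = m)"

lemma covers_finite: "finite I \<Longrightarrow> covers I r C \<Longrightarrow> finite C"
  unfolding covers_def by (meson finite_Pow_iff finite_subset)

lemma covers_Pow: "covers I r (Pow I)"
  unfolding covers_def near_def
proof (intro conjI allI impI)
  fix x assume "x \<subseteq> I"
  then show "\<exists>c\<in>Pow I. card (sym_diff x c) \<le> r" by (intro bexI[of _ x]) auto
qed auto

text \<open>Renaming coordinates preserves covering codes. This is what makes \<open>cov_num\<close>, defined with the
  coordinates \<open>{..<n}\<close>, usable for every coordinate set of size \<open>n\<close>.\<close>

lemma covers_bij:
  assumes f: "bij_betw f I J" and C: "covers I r C"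
  shows "covers J r ((`) f ` C)" "card ((`) f ` C) = card C"
proof -
  have inj: "inj_on f I" and J: "f ` I = J" using f by (auto simp: bij_betw_def)
  have sub: "C \<subseteq> Pow I" using C by (simp add: covers_def)
  show "card ((`) f ` C) = card C"
    by (rule card_image) (meson inj inj_on_image_Pow inj_on_subset sub)
  show "covers J r ((`) f ` C)"
    unfolding covers_def near_def
  proof (intro conjI allI impI)
    show "(`) f ` C \<subseteq> Pow J" using sub J by auto
    fix y assume "y \<subseteq> J"
    then obtain x where x: "x \<subseteq> I" "y = f ` x" using J by (metis subset_imageE)
    then obtain c where c: "c \<in> C" "card (sym_diff x c) \<le> r"
      using C unfolding covers_def near_def by blast
    have cI: "c \<subseteq> I" using c sub by auto
    have "sym_diff y (f ` c) = f ` (sym_diff x c)"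
      using x cI inj by (auto simp: inj_on_def)
    then have "card (sym_diff y (f ` c)) = card (sym_diff x c)"
      using inj x cI by (simp, intro card_image) (auto intro: inj_on_subset)
    then show "\<exists>c\<in>(`) f ` C. card (sym_diff y c) \<le> r"
      using c by (intro bexI[of _ "f ` c"]) auto
  qed
qed

lemma cov_num_attained:
  assumes "finite I" "card I = n"
  obtains C where "covers I r C" "card C = cov_num n r"
proof -
  have "\<exists>C. covers {..<n} r C \<and> card C = cov_num n r"
    unfolding cov_num_def by (rule LeastI_ex) (use covers_Pow in blast)
  then obtain C where C: "covers {..<n} r C" "card C = cov_num n r" by blast
  obtain f where "bij_betw f {..<n} I"
    using assms by (metis bij_betw_iff_card card_lessThan finite_lessThan)
  with C covers_bij[OF this C(1)] that show ?thesis by metis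
qed

lemma cov_num_le:
  assumes "finite I" "card I = n" "covers I r C"
  shows "cov_num n r \<le> card C"
proof -
  obtain f where "bij_betw f I {..<n}"
    using assms by (metis bij_betw_iff_card card_lessThan finite_lessThan)
  from covers_bij[OF this assms(3)] show ?thesis
    unfolding cov_num_def by (metis (mono_tags, lifting) Least_le)
qed

definition joint :: "'a set set \<Rightarrow> 'a set set \<Rightarrow> 'a set set" where
  "joint B C = (\<lambda>(b, c). b \<union> c) ` (B \<times> C)"

lemma card_joint_le: "finite B \<Longrightarrow> finite C \<Longrightarrow> card (joint B C) \<le> card B * card C"
  unfolding joint_def by (metis card_cartesian_product card_image_le finite_cartesian_product)

lemma near_joint:
  assumes "finite I" "finite J" "I \<inter> J = {}" "B \<subseteq> Pow I" "C \<subseteq> Pow J" "x \<subseteq> I \<union> J"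
    and "near r B (x \<inter> I)" "near s C (x \<inter> J)"
  shows "near (r + s) (joint B C) x"
proof -
  obtain b c where b: "b \<in> B" "card (sym_diff (x \<inter> I) b) \<le> r"
    and c: "c \<in> C" "card (sym_diff (x \<inter> J) c) \<le> s"
    using assms unfolding near_def by blast
  have bc: "b \<subseteq> I" "c \<subseteq> J" using assms b c by auto
  have "sym_diff x (b \<union> c) \<subseteq> sym_diff (x \<inter> I) b \<union> sym_diff (x \<inter> J) c"
    using assms bc by auto
  moreover have "finite (sym_diff (x \<inter> I) b \<union> sym_diff (x \<inter> J) c)"
    using assms bc by (auto intro: finite_subset)
  ultimately have "card (sym_diff x (b \<union> c)) \<le> card (sym_diff (x \<inter> I) b \<union> sym_diff (x \<inter> J) c)"
    by (rule card_mono[rotated])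
  also have "\<dots> \<le> card (sym_diff (x \<inter> I) b) + card (sym_diff (x \<inter> J) c)"
    by (rule card_Un_le)
  finally have "card (sym_diff x (b \<union> c)) \<le> r + s" using b c by linarith
  then show ?thesis unfolding near_def joint_def using b c by blast
qed

lemma joint_subset: "B \<subseteq> Pow I \<Longrightarrow> C \<subseteq> Pow J \<Longrightarrow> joint B C \<subseteq> Pow (I \<union> J)"
  unfolding joint_def by auto

lemma near_mono: "near r C x \<Longrightarrow> C \<subseteq> D \<Longrightarrow> near r D x"
  unfolding near_def by blast

text \<open>Where the first component of a word is well covered by \<open>B\<close>, a code of radius \<open>s\<close> suffices for the
  second component. The other first components are taken as codewords themselves, which leaves
  the whole radius \<open>r + s\<close> for the second component.\<close>

lemma cov_num_partial_sum:
  assumes B: "B \<subseteq> Pow {..<m}" and U: "U = {y. y \<subseteq> {..<m} \<and> \<not> near r B y}"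
  shows "cov_num (m + n) (r + s) \<le> card B * cov_num n s + card U * cov_num n (r + s)"
proof -
  let ?I = "{..<m}" and ?J = "{m..<m+n}"
  obtain A where A: "covers ?J s A" "card A = cov_num n s"
    using cov_num_attained[of ?J n s] by auto
  obtain D where D: "covers ?J (r + s) D" "card D = cov_num n (r + s)"
    using cov_num_attained[of ?J n "r + s"] by auto
  have IJ: "?I \<inter> ?J = {}" "?I \<union> ?J = {..<m+n}" by auto
  have sub: "A \<subseteq> Pow ?J" "D \<subseteq> Pow ?J" "U \<subseteq> Pow ?I" using A D U by (auto simp: covers_def)
  have fin: "finite A" "finite D" "finite B" "finite U"
    using sub B by (meson finite_Pow_iff finite_atLeastLessThan finite_lessThan finite_subset)+
  let ?C = "joint B A \<union> joint U D"
  have "covers (?I \<union> ?J) (r + s) ?C"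
    unfolding covers_def
  proof (intro conjI allI impI)
    show "?C \<subseteq> Pow (?I \<union> ?J)" using joint_subset[OF B sub(1)] joint_subset[OF sub(3,2)] by blast
    fix x assume x: "x \<subseteq> ?I \<union> ?J"
    show "near (r + s) ?C x"
    proof (cases "near r B (x \<inter> ?I)")
      case True
      have "near s A (x \<inter> ?J)" using A by (auto simp: covers_def)
      from near_joint[OF _ _ IJ(1) B sub(1) x True this] show ?thesis
        by (auto intro: near_mono)
    next
      case False
      then have "x \<inter> ?I \<in> U" using U by auto
      then have "near 0 U (x \<inter> ?I)" unfolding near_def by (intro bexI) auto
      moreover have "near (r + s) D (x \<inter> ?J)" using D by (auto simp: covers_def)
      ultimately have "near (0 + (r + s)) (joint U D) x"
        using near_joint[OF _ _ IJ(1) sub(3,2) x] by blast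
      then show ?thesis by (auto intro: near_mono)
    qed
  qed
  then have "cov_num (m + n) (r + s) \<le> card ?C"
    by (intro cov_num_le[of "{..<m+n}"]) (auto simp: IJ)
  also have "\<dots> \<le> card (joint B A) + card (joint U D)" by (rule card_Un_le)
  also have "\<dots> \<le> card B * card A + card U * card D"
    by (intro add_mono card_joint_le fin)
  finally show ?thesis using A D by simp
qed

lemma cov_num_pad: "cov_num (m + n) r \<le> 2 ^ m * cov_num n r"
proof -
  have "{} = {y. y \<subseteq> {..<m} \<and> \<not> near 0 (Pow {..<m}) y}"
    using covers_Pow[of "{..<m}" 0] by (auto simp: covers_def)
  from cov_num_partial_sum[OF subset_refl this, of n r] show ?thesis by (simp add: card_Pow)
qed

section \<open>Doubling\<close>

lemma odd_card_sym_diff_singleton: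
  "finite x \<Longrightarrow> odd (card (sym_diff x {i})) \<longleftrightarrow> even (card x)"
  by (cases "i \<in> x") (auto simp: card_Diff_singleton card_gt_0_iff)

text \<open>The classical (u | u + v) construction with a parity bit: the codewords are \<open>(p, x, x + c)\<close>, where
  \<open>c\<close> is a codeword and \<open>p\<close> the parity of \<open>x\<close>. For a word \<open>(p, x, y)\<close> the sum \<open>x + y\<close> is a codeword up to
  an error \<open>e\<close> of weight at most 1. If the parity bit is right, the error is corrected in \<open>y\<close>. If it is
  wrong, flipping in \<open>x\<close> the coordinate of \<open>e\<close> corrects the error and the parity at once, and for \<open>e = 0\<close>
  flipping the parity bit does.\<close>

lemma cov_num_double: "cov_num (2 * n + 1) 1 \<le> 2 ^ n * cov_num n 1"
proof -
  define I where "I = {..<n}"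
  obtain C where C: "covers I 1 C" "card C = cov_num n 1"
    using cov_num_attained[of I n 1] by (auto simp: I_def)
  have finI: "finite I" by (simp add: I_def)
  have CI: "C \<subseteq> Pow I" and finC: "finite C"
    using C covers_finite[OF finI C(1)] by (auto simp: covers_def)
  define w :: "bool \<Rightarrow> nat set \<Rightarrow> nat set \<Rightarrow> (bool \<times> nat) option set" where
    "w p x y = Some ` ({False} \<times> x \<union> {True} \<times> y) \<union> (if p then {None} else {})" for p x y
  define J where "J = w True I I"
  have cJ: "card J = 2 * n + 1" 
  proof -
    have "card (Some ` ({False} \<times> I \<union> {True} \<times> I)) = card ({False} \<times> I \<union> {True} \<times> I)"
      by (simp add: card_image)
    also have "\<dots> = card I + card I"
      using finI by (subst card_Un_disjoint) (auto simp: card_cartesian_product)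
    finally show ?thesis unfolding J_def w_def using finI by (simp add: I_def)
  qed
  have finJ: "finite J" using finI by (auto simp: J_def w_def)
  let ?D = "(\<lambda>(x, c). w (odd (card x)) x (sym_diff x c)) ` (Pow I \<times> C)"
  have mem: "w (odd (card x)) x y \<in> ?D" if "x \<subseteq> I" "sym_diff x y \<in> C" for x y
  proof -
    have "sym_diff x (sym_diff x y) = y" by auto
    then show ?thesis using that by (intro image_eqI[of _ _ "(x, sym_diff x y)"]) auto
  qed
  have "covers J 1 ?D"
    unfolding covers_def
  proof (intro conjI allI impI)
    show "?D \<subseteq> Pow J" 
    proof
      fix z assume "z \<in> ?D"
      then obtain x c where z: "z = w (odd (card x)) x (sym_diff x c)" "x \<subseteq> I" "c \<in> C" by auto
      then have "sym_diff x c \<subseteq> I" using CI by blast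
      with z show "z \<in> Pow J" by (auto simp: J_def w_def split: if_splits)
    qed
    fix z assume z: "z \<subseteq> J"
    define p x y where "p \<longleftrightarrow> None \<in> z" and "x = {i. Some (False, i) \<in> z}"
      and "y = {i. Some (True, i) \<in> z}"
    have zw: "z = w p x y"
    proof (rule Set.set_eqI)
      fix a :: "(bool \<times> nat) option"
      consider "a = None" | i where "a = Some (False, i)" | i where "a = Some (True, i)"
        proof (cases a)
          case (Some q)
          obtain p' i where "q = (p', i)" by fastforce
          with Some that show ?thesis by (cases p') auto
        qed (use that in auto)
      then show "a \<in> z \<longleftrightarrow> a \<in> w p x y"
      proof cases
        case 1
        show ?thesis unfolding 1 w_def p_def by auto
      next
        case 2
        show ?thesis unfolding 2 w_def x_def by auto
      next
        case 3
        show ?thesis unfolding 3 w_def y_def by auto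
      qed
    qed
    have xy: "x \<subseteq> I" "y \<subseteq> I" using z by (auto simp: J_def w_def x_def y_def)
    have finx: "finite x" using xy finI finite_subset by blast
    obtain c where c: "c \<in> C" "card (sym_diff (sym_diff x y) c) \<le> 1"
    proof -
      have "sym_diff x y \<subseteq> I" using xy by blast
      then show ?thesis using C(1) that unfolding covers_def near_def by blast
    qed
    have cI: "c \<subseteq> I" using c CI by auto
    have fin: "finite (sym_diff (sym_diff x y) c)"
      by (rule finite_subset[OF _ finI]) (use xy cI in blast)
    have "\<exists>d\<in>?D. card (sym_diff z d) \<le> 1"
    proof (cases "p \<longleftrightarrow> odd (card x)")
      case True
      let ?y = "sym_diff x c"
      have "sym_diff x ?y = c" by auto
      then have "w p x ?y \<in> ?D" using mem[of x ?y] xy c True by simp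
      moreover have "sym_diff z (w p x ?y) \<subseteq> (\<lambda>i. Some (True, i)) ` sym_diff (sym_diff x y) c"
        unfolding zw w_def by auto
      then have "card (sym_diff z (w p x ?y)) \<le> card (sym_diff (sym_diff x y) c)"
        by (rule surj_card_le[OF fin])
      ultimately show ?thesis using c by (intro bexI[of _ "w p x ?y"]) (rule le_trans)
    next
      case False
      show ?thesis
      proof (cases "sym_diff (sym_diff x y) c = {}")
        case True
        then have "sym_diff x y = c" by blast
        then have "w (odd (card x)) x y \<in> ?D" using mem xy c by blast
        moreover have "sym_diff z (w (odd (card x)) x y) \<subseteq> {None}"
          unfolding zw w_def by auto
        then have "card (sym_diff z (w (odd (card x)) x y)) \<le> card {None :: (bool \<times> nat) option}"
          by (intro card_mono) auto
        ultimately show ?thesis by (intro bexI[of _ "w (odd (card x)) x y"]) auto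
      next
        case ne: False
        then have "card (sym_diff (sym_diff x y) c) = 1"
          using c(2) fin by (metis card_0_eq le_antisym less_one linorder_not_less)
        then obtain i where i: "sym_diff (sym_diff x y) c = {i}" by (auto simp: card_1_singleton_iff)
        let ?x = "sym_diff x {i}"
        have iI: "i \<in> I" using i xy cI by blast
        have "sym_diff ?x y = c" using i by (auto simp: set_eq_iff)
        moreover have "odd (card ?x) \<longleftrightarrow> p" using odd_card_sym_diff_singleton[OF finx] False by blast
        ultimately have "w p ?x y \<in> ?D" using mem[of ?x y] xy iI c by auto
        moreover have "sym_diff z (w p ?x y) \<subseteq> {Some (False, i)}"
          unfolding zw w_def by auto
        then have "card (sym_diff z (w p ?x y)) \<le> card {Some (False, i)}"
          by (intro card_mono) auto
        ultimately show ?thesis by (intro bexI[of _ "w p ?x y"]) auto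
      qed
    qed
    then show "near 1 ?D z" unfolding near_def .
  qed
  then have "cov_num (2 * n + 1) 1 \<le> card ?D" by (rule cov_num_le[OF finJ cJ])
  also have "\<dots> \<le> card (Pow I \<times> C)" using finI finC by (intro card_image_le) auto
  also have "\<dots> = 2 ^ n * cov_num n 1"
    using C finI by (simp add: card_cartesian_product card_Pow I_def)
  finally show ?thesis .
qed

section \<open>Radius-one codes from cyclic groups\<close>

text \<open>The coordinates are labelled by the nonzero vectors of \<open>F_2^b\<close>, here the nonempty subsets of \<open>{..<b}\<close>,
  and \<open>syn\<close> is the Hamming syndrome. Flipping the coordinate with label \<open>v\<close> adds \<open>v\<close> to the syndrome, so
  one flip reaches every syndrome. Collapsing the \<open>2^b\<close> syndromes onto \<open>M\<close> colours keeps this property.\<close>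

lemma hamming_colouring:
  assumes N: "N = 2 ^ b - 1" and M: "0 < M" "M \<le> 2 ^ b"
  obtains \<sigma> :: "nat set \<Rightarrow> nat" where
    "\<And>y. \<sigma> y < M"
    "\<And>y t. y \<subseteq> {..<N} \<Longrightarrow> t < M \<Longrightarrow> \<exists>y'\<subseteq>{..<N}. card (sym_diff y y') \<le> 1 \<and> \<sigma> y' = t"
proof -
  let ?S = "Pow {..<b}"
  have cS: "card (?S - {{}}) = N" using N by (simp add: card_Pow card_Diff_singleton)
  have "\<exists>f. bij_betw f {..<N} (?S - {{}})" by (rule finite_same_card_bij) (simp_all add: cS)
  then obtain f where f: "bij_betw f {..<N} (?S - {{}})" by blast
  have "\<exists>e. bij_betw e ?S {..<2 ^ b :: nat}" by (rule finite_same_card_bij) (simp_all add: card_Pow)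
  then obtain e :: "nat set \<Rightarrow> nat" where e: "bij_betw e ?S {..<2 ^ b}" by blast
  define g where "g s = e s mod M" for s
  have g_surj: "\<exists>s\<in>?S. g s = t" if "t < M" for t
  proof -
    have "t \<in> e ` ?S" using that M e by (auto simp: bij_betw_def)
    then obtain s where "s \<in> ?S" "e s = t" by blast
    with that show ?thesis by (intro bexI[of _ s]) (simp_all add: g_def)
  qed
  define syn where "syn y = {k. k < b \<and> odd (card {i \<in> y. k \<in> f i})}" for y
  show ?thesis
  proof
    show "g (syn y) < M" for y using M by (simp add: g_def)
    fix y t assume y: "y \<subseteq> {..<N}" and t: "t < M"
    have finy: "finite y" using y finite_subset by blast
    obtain s where s: "s \<in> ?S" "g s = t" using g_surj t by blast
    have synS: "syn y \<in> ?S" by (auto simp: syn_def)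
    show "\<exists>y'\<subseteq>{..<N}. card (sym_diff y y') \<le> 1 \<and> g (syn y') = t"
    proof (cases "syn y = s")
      case True
      then show ?thesis using y s by (intro exI[of _ y]) auto
    next
      case False
      then have "sym_diff (syn y) s \<in> ?S - {{}}" using s synS by blast
      then obtain i where i: "i < N" "f i = sym_diff (syn y) s"
        using f unfolding bij_betw_def by (metis image_iff lessThan_iff)
      define y' where "y' = sym_diff y {i}"
      have "syn y' = s"
      proof (rule Set.set_eqI)
        fix k
        let ?A = "{j \<in> y. k \<in> f j}"
        have "{j \<in> y'. k \<in> f j} = (if k \<in> f i then sym_diff ?A {i} else ?A)"
          by (auto simp: y'_def)
        moreover have "odd (card (sym_diff ?A {i})) \<longleftrightarrow> even (card ?A)"
          by (rule odd_card_sym_diff_singleton) (use finy in auto)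
        ultimately have "k \<in> syn y' \<longleftrightarrow> k < b \<and> (k \<in> f i \<longleftrightarrow> k \<notin> syn y)"
          by (auto simp: syn_def)
        then show "k \<in> syn y' \<longleftrightarrow> k \<in> s" using i s synS by auto
      qed
      moreover have "sym_diff y y' = {i}" by (auto simp: y'_def)
      moreover have "y' \<subseteq> {..<N}" using y i by (auto simp: y'_def)
      ultimately show ?thesis using s by (intro exI[of _ y']) auto
    qed
  qed
qed

definition vecs :: "int \<Rightarrow> nat \<Rightarrow> int list set" where
  "vecs N m = {v. set v \<subseteq> {0..<N} \<and> length v = m}"

definition nonunits :: "int \<Rightarrow> int set" where
  "nonunits N = {a \<in> {0..<N}. \<not> coprime a N}"

text \<open>Generators of cyclic subgroups that together exhaust \<open>(\<int> / N)^m\<close>: the vectors whose first unit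
  coordinate is 1, and the vectors without unit coordinates.\<close>

primrec directions :: "int \<Rightarrow> nat \<Rightarrow> int list set" where
  "directions N 0 = {[]}"
| "directions N (Suc m) =
     (#) 1 ` vecs N m \<union> (\<lambda>(a, h). a # h) ` (nonunits N \<times> directions N m)"

lemma finite_vecs: "finite (vecs N m)"
  unfolding vecs_def by (rule finite_lists_length_eq) simp

lemma card_vecs: "card (vecs N m) = nat N ^ m"
  unfolding vecs_def by (subst card_lists_length_eq) simp_all

lemma finite_nonunits: "finite (nonunits N)"
  unfolding nonunits_def by (rule finite_subset[of _ "{0..<N}"]) auto

lemma finite_directions: "finite (directions N m)"
  by (induction m) (simp_all add: finite_vecs finite_nonunits)

lemma unit_inverse:
  fixes a N :: int
  assumes "coprime a N"
  obtains a' where "\<And>x. (a * a' * x) mod N = x mod N" "coprime a' N"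
proof -
  obtain a' where a': "[a * a' = 1] (mod N)" using assms cong_solve_coprime_int by blast
  have "(a * a' * x) mod N = x mod N" for x
    using cong_scalar_right[OF a', of x] by (simp add: cong_def)
  moreover have "coprime a' N"
    using a' by (metis cong_imp_coprime coprime_1_left coprime_mult_left_iff cong_sym)
  ultimately show ?thesis using that by blast
qed

text \<open>A vector with a unit coordinate is normalised by dividing by the first one. The multiplier \<open>c\<close> has to
  be a unit for the induction: a nonunit put in front is then divided by \<open>c\<close> and stays a nonunit.\<close>

lemma multiple_of_direction:
  assumes N: "N > 1" and v: "v \<in> vecs N m"
  shows "\<exists>h\<in>directions N m. \<exists>c. coprime c N \<and> v = map (\<lambda>a. (c * a) mod N) h"
  using v
proof (induction m arbitrary: v)
  case 0
  then show ?case by (auto simp: vecs_def intro: exI[of _ 1])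
next
  case (Suc m)
  then obtain a w where v: "v = a # w" and a: "0 \<le> a" "a < N" and w: "w \<in> vecs N m"
    by (cases v) (auto simp: vecs_def)
  have wN: "x mod N = x" if "x \<in> set w" for x using that w by (auto simp: vecs_def)
  show ?case
  proof (cases "coprime a N")
    case True
    obtain a' where a': "\<And>x. (a * a' * x) mod N = x mod N" using unit_inverse[OF True] by metis
    let ?h = "map (\<lambda>x. (a' * x) mod N) w"
    have "?h \<in> vecs N m" using w N by (auto simp: vecs_def)
    moreover have "map (\<lambda>x. (a * x) mod N) ?h = w"
      using wN a' by (simp add: mod_mult_right_eq mult.assoc[symmetric] map_idI)
    ultimately show ?thesis using True a v by (intro bexI[of _ "1 # ?h"] exI[of _ a]) auto
  next
    case False
    obtain h c where h: "h \<in> directions N m" and c: "coprime c N"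
      and w': "w = map (\<lambda>a. (c * a) mod N) h" using Suc.IH[OF w] by blast
    obtain c' where c': "\<And>x. (c * c' * x) mod N = x mod N" "coprime c' N"
      using unit_inverse[OF c] by metis
    let ?a = "(c' * a) mod N"
    have "\<not> coprime ?a N" using False c' N by (metis coprime_mod_left_iff coprime_mult_left_iff less_irrefl not_one_less_zero)
    then have "?a \<in> nonunits N" using N by (simp add: nonunits_def)
    moreover have "(c * ?a) mod N = a"
      using a c'(1)[of a] by (simp add: mod_mult_right_eq mult.assoc[symmetric])
    ultimately show ?thesis
      using h c v w' by (intro bexI[of _ "?a # h"] exI[of _ c]) auto
  qed
qed

text \<open>The cardinalities satisfy \<open>d (m + 1) \<le> N^m + \<nu> d m\<close>. The sum of the geometric series is about
  \<open>N^m / (N - \<nu>)\<close>, and \<open>\<nu>^m\<close> accounts for the vectors of nonunits.\<close>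

lemma card_directions:
  fixes N :: int
  assumes N: "N > 0" defines "\<nu> \<equiv> card (nonunits N)"
  shows "real (card (directions N m)) * (real_of_int N - real \<nu>)
         \<le> real_of_int N ^ m + (real_of_int N - real \<nu>) * real \<nu> ^ m"
proof (induction m)
  case 0
  then show ?case using N by simp
next
  case (Suc m)
  let ?d = "real_of_int N - real \<nu>"
  have "nonunits N \<subseteq> {0..<N}" by (auto simp: nonunits_def)
  then have "\<nu> \<le> card {0..<N}" unfolding \<nu>_def by (intro card_mono) auto
  then have d0: "?d \<ge> 0" using N by simp
  have "card (directions N (Suc m)) \<le> card ((#) 1 ` vecs N m)
     + card ((\<lambda>(a, h). a # h) ` (nonunits N \<times> directions N m))"
    by (simp add: card_Un_le)
  also have "\<dots> \<le> card (vecs N m) + card (nonunits N \<times> directions N m)"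
    by (intro add_mono card_image_le) (simp_all add: finite_vecs finite_nonunits finite_directions)
  also have "\<dots> = nat N ^ m + \<nu> * card (directions N m)"
    by (simp add: card_vecs card_cartesian_product \<nu>_def)
  finally have "real (card (directions N (Suc m))) \<le> real (nat N ^ m + \<nu> * card (directions N m))"
    by (rule of_nat_mono)
  also have "\<dots> = real_of_int N ^ m + \<nu> * card (directions N m)"
    using N by simp
  finally have "real (card (directions N (Suc m))) * ?d
      \<le> (real_of_int N ^ m + \<nu> * card (directions N m)) * ?d"
    using d0 by (rule mult_right_mono)
  also have "\<dots> = real_of_int N ^ m * ?d + \<nu> * (card (directions N m) * ?d)"
    by (simp add: algebra_simps)
  also have "\<dots> \<le> real_of_int N ^ m * ?d + \<nu> * (real_of_int N ^ m + ?d * real \<nu> ^ m)"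
    by (intro add_left_mono mult_left_mono Suc.IH) simp
  also have "\<dots> = real_of_int N ^ Suc m + ?d * real \<nu> ^ Suc m"
    by (simp add: algebra_simps)
  finally show ?case .
qed

text \<open>A generalised Hamming code: each direction \<open>h\<close> gets a block of \<open>N\<close> coordinates, the colour \<open>\<sigma>\<close> of
  the block in \<open>\<int> / N\<close> is the coefficient of \<open>h\<close>, and the syndrome is the sum of these multiples of
  directions. The difference between two syndromes is a multiple \<open>c h\<close> of one direction, and a
  single flip in the block of \<open>h\<close> changes the coefficient by \<open>c\<close>. So each of the \<open>N^m\<close> classes of words
  with a given syndrome covers with radius 1, and the smallest one has at most \<open>2^n / N^m\<close> elements.\<close>

lemma cov_num_cyclic:
  fixes b m :: nat
  defines "N \<equiv> 2 ^ b - 1 :: nat"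
  defines "n \<equiv> card (directions (int N) m) * N"
  assumes N1: "N > 1"
  shows "N ^ m * cov_num n 1 \<le> 2 ^ n"
proof -
  obtain \<sigma> :: "nat set \<Rightarrow> nat" where \<sigma>: "\<And>y. \<sigma> y < N"
    "\<And>y t. y \<subseteq> {..<N} \<Longrightarrow> t < N \<Longrightarrow> \<exists>y'\<subseteq>{..<N}. card (sym_diff y y') \<le> 1 \<and> \<sigma> y' = t"
    using hamming_colouring[of N b N] N1 by (auto simp: N_def)
  define H where "H = directions (int N) m"
  define I where "I = H \<times> {..<N}"
  have finH: "finite H" by (simp add: H_def finite_directions)
  have finI: "finite I" by (simp add: I_def finH)
  have cI: "card I = n" by (simp add: I_def n_def H_def card_cartesian_product)
  define block where "block x h = {i. (h, i) \<in> x}" for x :: "(int list \<times> nat) set" and h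
  define T where "T x l = (\<Sum>h\<in>H. int (\<sigma> (block x h)) * h ! l)" for x l
  define S where "S x = map (\<lambda>l. T x l mod int N) [0..<m]" for x
  have S_vecs: "S x \<in> vecs (int N) m" for x using N1 by (auto simp: S_def vecs_def)
  define C where "C s = {x. x \<subseteq> I \<and> S x = s}" for s
  have cov: "covers I 1 (C s)" if s: "s \<in> vecs (int N) m" for s
    unfolding covers_def
  proof (intro conjI allI impI)
    show "C s \<subseteq> Pow I" by (auto simp: C_def)
    fix x assume x: "x \<subseteq> I"
    let ?d = "map (\<lambda>l. (s ! l - T x l) mod int N) [0..<m]"
    have "?d \<in> vecs (int N) m" using N1 by (auto simp: vecs_def)
    then obtain h c where h: "h \<in> H" and d: "?d = map (\<lambda>a. (c * a) mod int N) h"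
      using multiple_of_direction[of "int N" ?d m] N1 by (auto simp: H_def)
    have len: "length h = m" using arg_cong[OF d, of length] by simp
    have dl: "(s ! l - T x l) mod int N = (c * h ! l) mod int N" if "l < m" for l
      using arg_cong[OF d, of "\<lambda>v. v ! l"] that len by simp
    define y where "y = block x h"
    have yN: "y \<subseteq> {..<N}" using x by (auto simp: y_def block_def I_def)
    define t where "t = nat ((int (\<sigma> y) + c) mod int N)"
    have tN: "t < N" and t: "int t = (int (\<sigma> y) + c) mod int N"
      using N1 by (auto simp: t_def nat_less_iff)
    obtain y' where y': "y' \<subseteq> {..<N}" "card (sym_diff y y') \<le> 1" "\<sigma> y' = t"
      using \<sigma>(2)[OF yN tN] by blast
    define x' where "x' = (x - {h} \<times> UNIV) \<union> {h} \<times> y'"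
    have x'I: "x' \<subseteq> I" using x y' h by (auto simp: x'_def I_def)
    have blk: "block x' h = y'" "g \<noteq> h \<Longrightarrow> block x' g = block x g" for g
      by (auto simp: block_def x'_def)
    have "S x' = s"
    proof (rule nth_equalityI)
      show "length (S x') = length s" using s by (simp add: S_def vecs_def)
      fix l assume "l < length (S x')"
      then have l: "l < m" by (simp add: S_def)
      let ?r = "\<Sum>g\<in>H - {h}. int (\<sigma> (block x g)) * g ! l"
      have Tx: "T x l = int (\<sigma> y) * h ! l + ?r"
        unfolding T_def y_def by (rule sum.remove[OF finH h])
      have Tx': "T x' l = int t * h ! l + ?r"
          proof -
        have "T x' l = int (\<sigma> (block x' h)) * h ! l
            + (\<Sum>g\<in>H - {h}. int (\<sigma> (block x' g)) * g ! l)"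
          unfolding T_def by (rule sum.remove[OF finH h])
        also have "(\<Sum>g\<in>H - {h}. int (\<sigma> (block x' g)) * g ! l) = ?r"
          by (intro sum.cong) (auto simp: blk)
        finally show ?thesis by (simp add: blk y')
      qed
      have "[T x' l = (int (\<sigma> y) + c) * h ! l + ?r] (mod int N)"
        unfolding Tx' t by (intro cong_add cong_mult cong_refl) (simp add: cong_def)
      also have "(int (\<sigma> y) + c) * h ! l + ?r = T x l + c * h ! l"
        unfolding Tx by (simp add: algebra_simps)
      also have "[T x l + c * h ! l = T x l + (s ! l - T x l)] (mod int N)"
        using dl[OF l] by (intro cong_add cong_refl) (simp add: cong_def)
      finally have "T x' l mod int N = s ! l mod int N" by (simp add: cong_def)
      moreover have "s ! l \<in> {0..<int N}" using s l by (metis (mono_tags, lifting) mem_Collect_eq nth_mem subsetD vecs_def)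
      ultimately show "S x' ! l = s ! l" using l by (simp add: S_def)
    qed
    then have "x' \<in> C s" using x'I by (simp add: C_def)
    moreover have "sym_diff x x' = Pair h ` sym_diff y y'"
      by (auto simp: x'_def y_def block_def)
    then have "card (sym_diff x x') = card (sym_diff y y')"
      by (simp add: card_image inj_on_def)
    ultimately show "near 1 (C s) x" using y' unfolding near_def by (intro bexI[of _ x']) simp_all
  qed
  have "N ^ m * cov_num n 1 = (\<Sum>s\<in>vecs (int N) m. cov_num n 1)"
    by (simp add: card_vecs)
  also have "\<dots> \<le> (\<Sum>s\<in>vecs (int N) m. card (C s))"
    by (intro sum_mono cov_num_le[OF finI cI] cov)
  also have "\<dots> = card (\<Union>s\<in>vecs (int N) m. C s)"
    by (rule card_UN_disjoint[symmetric]) (auto simp: finite_vecs C_def finI)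
  also have "(\<Union>s\<in>vecs (int N) m. C s) = Pow I" using S_vecs by (auto simp: C_def)
  also have "card (Pow I) = 2 ^ n" by (simp add: card_Pow finI cI)
  finally show ?thesis .
qed

section \<open>Mersenne numbers with few nonunits\<close>

text \<open>The order of 2 modulo \<open>p\<close> divides the prime \<open>b\<close> and is not 1, so it is \<open>b\<close>; it also divides \<open>p - 1\<close>.\<close>

lemma mersenne_prime_factor:
  fixes b p :: nat
  assumes b: "prime b" and p: "prime p" "p dvd 2 ^ b - 1"
  shows "b < p"
proof -
  have c1: "[2 ^ b = 1] (mod p)" 
    using p(2) by (metis cong_altdef_nat cong_sym one_le_numeral one_le_power)
  then have "ord p 2 dvd b" by (simp only: ord_divides)
  moreover have "ord p 2 \<noteq> 1"
  proof
    assume "ord p 2 = 1"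
    then have "[2 ^ 1 = 1] (mod p)" by (simp only: ord_divides) simp
    then have "p dvd 2 - 1" by (simp add: cong_altdef_nat)
    then show False using p(1) by simp
  qed
  ultimately have ord: "ord p 2 = b" using b by (metis prime_nat_iff)
  have "\<not> p dvd 2"
  proof
    assume "p dvd 2"
    then have "p dvd 2 ^ b" using b by (meson dvd_power dvd_trans prime_gt_0_nat)
    then have "p dvd 2 ^ b - (2 ^ b - 1)" using p(2) by (rule dvd_diff_nat)
    then show False using p(1) by simp
  qed
  then have "[2 ^ (p - 1) = 1] (mod p)" using p(1) by (intro fermat_theorem)
  then have "b dvd p - 1" using ord by (simp only: ord_divides)
  then have "b \<le> p - 1" using p(1) by (intro dvd_imp_le) (auto dest: prime_gt_1_nat)
  then show ?thesis using p(1) prime_gt_1_nat[of p] by linarith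
qed

text \<open>All prime factors of \<open>N\<close> exceed \<open>b\<close>, and their product is below \<open>2^b\<close>, so there are at most \<open>b / log 2 b\<close>
  of them. Each of them divides at most \<open>N / b\<close> of the residues.\<close>

lemma card_nonunits_le:
  fixes b :: nat
  assumes b: "prime b"
  defines "N \<equiv> 2 ^ b - 1 :: nat"
  shows "real (card (nonunits (int N))) * log 2 b \<le> N"
proof -
  have N0: "N > 0" using less_exp[of b] prime_gt_1_nat[OF b] unfolding N_def by linarith
  let ?P = "prime_factors N"
  have P: "prime p" "p dvd N" "b < p" if "p \<in> ?P" for p
    using that mersenne_prime_factor[OF b] by (auto simp: N_def)
  have "b ^ card ?P = (\<Prod>p\<in>?P. b)" by simp
  also have "\<dots> \<le> (\<Prod>p\<in>?P. p ^ multiplicity p N)"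
  proof (intro prod_mono conjI)
    fix p assume p: "p \<in> ?P"
    then have "1 \<le> multiplicity p N"
      using N0 by (simp add: prime_factors_multiplicity)
    then have "p ^ 1 \<le> p ^ multiplicity p N"
      using prime_gt_0_nat[OF P(1)[OF p]] by (intro power_increasing) simp_all
    then show "b \<le> p ^ multiplicity p N" using P(3)[OF p] by simp
  qed simp
  also have "\<dots> = N" using prime_factorization_nat[of N] N0 by simp
  also have "\<dots> < 2 ^ b" by (simp add: N_def)
  finally have "real (b ^ card ?P) \<le> 2 ^ b"
    by (metis less_imp_le of_nat_le_iff of_nat_numeral of_nat_power)
  then have "log 2 (real b ^ card ?P) \<le> log 2 (2 ^ b)"
    using prime_gt_0_nat[OF b] by (subst log_le_cancel_iff) auto
  then have w: "real (card ?P) * log 2 b \<le> b"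
    using prime_gt_0_nat[OF b] by (simp add: log_nat_power)
  have sub: "nonunits (int N) \<subseteq> (\<Union>p\<in>?P. (\<lambda>k. int p * k) ` {0..<int (N div p)})"
  proof
    fix a assume "a \<in> nonunits (int N)"
    then have a: "0 \<le> a" "a < int N" "\<not> coprime a (int N)" by (auto simp: nonunits_def)
    then have "\<not> coprime (nat a) N" using coprime_int_iff[of "nat a" N] by simp
    then have "gcd (nat a) N \<noteq> 1" by (metis coprime_iff_gcd_eq_1)
    then obtain p where p: "prime p" "p dvd nat a" "p dvd N"
      using prime_factor_nat[of "gcd (nat a) N"] by (meson dvd_trans gcd_dvd1 gcd_dvd2)
    from p(2) obtain k where k: "nat a = p * k" by (rule dvdE)
    have "a = int (nat a)" using a(1) by simp
    then have "a = int p * int k" unfolding k by simp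
    moreover have "p * k < N" using k a by linarith
    then have "p * k < p * (N div p)" using p(3) by simp
    then have "k < N div p" by simp
    moreover have "p \<in> ?P" using p N0 by (simp add: prime_factors_dvd)
    ultimately show "a \<in> (\<Union>p\<in>?P. (\<lambda>k. int p * k) ` {0..<int (N div p)})" by force
  qed
  have "card (nonunits (int N)) \<le> card (\<Union>p\<in>?P. (\<lambda>k. int p * k) ` {0..<int (N div p)})"
    by (intro card_mono sub) auto
  also have "\<dots> \<le> (\<Sum>p\<in>?P. card ((\<lambda>k. int p * k) ` {0..<int (N div p)}))"
    by (rule card_UN_le) simp
  also have "\<dots> \<le> (\<Sum>p\<in>?P. N div p)"
    by (intro sum_mono) (metis card_atLeastLessThan_int card_image_le diff_zero finite_atLeastLessThan_int nat_int)
  finally have "real (card (nonunits (int N))) \<le> real (\<Sum>p\<in>?P. N div p)" by (rule of_nat_mono)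
  also have "\<dots> \<le> (\<Sum>p\<in>?P. real N / b)"
    unfolding of_nat_sum
  proof (rule sum_mono)
    fix p assume p: "p \<in> ?P"
    have "real (N div p) \<le> real N / p" by (rule of_nat_div_le_of_nat)
    also have "\<dots> \<le> real N / b" using P(3)[OF p] prime_gt_0_nat[OF b] by (intro divide_left_mono) auto
    finally show "real (N div p) \<le> real N / b" .
  qed
  also have "\<dots> = card ?P * (real N / b)" by simp
  finally have "real (card (nonunits (int N))) * log 2 b \<le> card ?P * (real N / b) * log 2 b"
    using prime_gt_1_nat[OF b] by (intro mult_right_mono) auto
  also have "\<dots> = (card ?P * log 2 b) * (real N / b)" by simp
  also have "\<dots> \<le> b * (real N / b)" by (intro mult_right_mono w) simp
  also have "\<dots> = N" using prime_gt_0_nat[OF b] by simp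
  finally show ?thesis .
qed

lemma mersenne_few_nonunits:
  fixes \<rho> :: real
  assumes "\<rho> > 0"
  obtains b :: nat where "(2 ^ b - 1 :: nat) > 1" "1 / real (2 ^ b - 1 :: nat) \<le> \<rho>"
    "real (card (nonunits (int (2 ^ b - 1)))) \<le> \<rho> * real (2 ^ b - 1 :: nat)"
proof -
  obtain k :: nat where k: "1 / \<rho> \<le> real k" using real_arch_simple by blast
  obtain b :: nat where b: "prime b" "2 ^ (k + 2) < b" using bigger_prime by blast
  define N :: nat where "N = 2 ^ b - 1"
  have "b < 2 ^ b" by (rule less_exp)
  then have bN: "b \<le> N" unfolding N_def by linarith
  have k2: "real k < 2 ^ (k + 2)"
  proof -
    have "real k < 2 ^ k" by (rule of_nat_less_two_power)
    also have "(2::real) ^ k \<le> 2 ^ (k + 2)" by (intro power_increasing) auto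
    finally show ?thesis .
  qed
  have kb: "real k \<le> log 2 b"
  proof -
    have "2 ^ k \<le> (2::real) ^ (k + 2)" by (intro power_increasing) auto
    also have "\<dots> \<le> real b" using b(2) by (metis less_imp_le of_nat_le_iff of_nat_numeral of_nat_power)
    finally have "2 powr (real k) \<le> real b" by (simp add: powr_realpow)
    then show ?thesis using prime_gt_0_nat[OF b(1)] by (subst le_log_iff) auto
  qed
  have 1: "1 < N" using bN b(2) prime_gt_1_nat[OF b(1)] by linarith
  have "real k \<le> N"
  proof -
    have "real k < 2 ^ (k + 2)" by (fact k2)
    also have "\<dots> < real b" using b(2) by (metis of_nat_less_iff of_nat_numeral of_nat_power)
    finally show ?thesis using bN by linarith
  qed
  then have "1 / \<rho> \<le> N" using k by linarith
  then have 2: "1 / real N \<le> \<rho>" using assms 1 by (simp add: field_simps)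
  let ?\<nu> = "real (card (nonunits (int N)))"
  have "?\<nu> * (1 / \<rho>) \<le> ?\<nu> * log 2 b" using k kb by (intro mult_left_mono) auto
  also have "\<dots> \<le> N" using card_nonunits_le[OF b(1)] by (simp add: N_def)
  finally have "?\<nu> \<le> \<rho> * N" using assms by (simp add: field_simps)
  with 1 2 that[of b] show ?thesis by (simp add: N_def)
qed

section \<open>Radius one at every length\<close>

text \<open>The length of the code of \<open>cov_num_cyclic\<close> is nearly its index \<open>N^m\<close>: with \<open>\<nu> \<le> \<rho> N\<close> nonunits, the
  quotient is at most \<open>1 / (1 - \<rho>) + N \<rho>^m\<close>, and the second term vanishes for large \<open>m\<close>. The bound is
  for the length plus one, because this is the quantity that is doubled by \<open>cov_num_double\<close>.\<close>

lemma short_cyclic_codes: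
  fixes \<eta> :: real
  assumes \<eta>: "\<eta> > 0"
  obtains b m0 where "(2 ^ b - 1 :: nat) > 1" "1 / real (2 ^ b - 1 :: nat) \<le> \<eta>"
    "\<And>m. m \<ge> m0 \<Longrightarrow> real (card (directions (int (2 ^ b - 1)) m) * (2 ^ b - 1) + 1)
       \<le> (1 + \<eta>) * real (2 ^ b - 1 :: nat) ^ m"
proof -
  define \<rho> where "\<rho> = min (1 / 2) (\<eta> / 4)"
  have \<rho>: "0 < \<rho>" "\<rho> \<le> 1 / 2" "\<rho> \<le> \<eta> / 4" using \<eta> by (auto simp: \<rho>_def)
  obtain b :: nat where b: "(2 ^ b - 1 :: nat) > 1" "1 / real (2 ^ b - 1 :: nat) \<le> \<rho>"
    "real (card (nonunits (int (2 ^ b - 1)))) \<le> \<rho> * real (2 ^ b - 1 :: nat)"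
    using mersenne_few_nonunits[OF \<rho>(1)] .
  define N :: nat where "N = 2 ^ b - 1"
  define \<nu> where "\<nu> = card (nonunits (int N))"
  have intN: "int N = 2 ^ b - 1" by (simp add: N_def of_nat_diff)
  have N1: "N > 1" using b by (simp add: N_def)
  have \<nu>: "real \<nu> \<le> \<rho> * N" using b(3) unfolding \<nu>_def intN by (simp add: N_def)
  have "(\<lambda>m. real N * \<rho> ^ m + (1 / real N) ^ m) \<longlonglongrightarrow> real N * 0 + 0"
    using \<rho> N1 by (intro tendsto_add tendsto_mult tendsto_const LIMSEQ_power_zero) auto
  then have "\<forall>\<^sub>F m in sequentially. real N * \<rho> ^ m + (1 / real N) ^ m < \<eta> / 2"
    using \<eta> by (intro order_tendstoD) auto
  then obtain m0 where m0: "\<And>m. m \<ge> m0 \<Longrightarrow> real N * \<rho> ^ m + (1 / real N) ^ m < \<eta> / 2"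
    by (auto simp: eventually_sequentially)
  have main: "real (card (directions (int N) m) * N + 1) \<le> (1 + \<eta>) * real N ^ m" if m: "m \<ge> m0" for m
  proof -
    let ?D = "real (card (directions (int N) m))"
    have pos: "real N * (1 - \<rho>) > 0" using \<rho> N1 by simp
    have le: "real N * (1 - \<rho>) \<le> real N - \<nu>" using \<nu> by (simp add: algebra_simps)
    have "?D * (real N - \<nu>) \<le> real N ^ m + (real N - \<nu>) * real \<nu> ^ m"
      using card_directions[of "int N" m] N1 by (simp add: \<nu>_def)
    then have "?D \<le> real N ^ m / (real N - \<nu>) + real \<nu> ^ m"
      using pos le by (simp add: field_simps)
    also have "\<dots> \<le> real N ^ m / (real N * (1 - \<rho>)) + real \<nu> ^ m"
      using pos le by (intro add_right_mono divide_left_mono) auto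
    finally have "?D * N \<le> (real N ^ m / (real N * (1 - \<rho>)) + real \<nu> ^ m) * N"
      by (rule mult_right_mono) simp
    also have "\<dots> = real N ^ m * (1 / (1 - \<rho>)) + N * real \<nu> ^ m"
      using N1 \<rho> by (simp add: field_simps)
    also have "\<dots> \<le> real N ^ m * (1 + \<eta> / 2) + N * (\<rho> * N) ^ m"
    proof (intro add_mono mult_left_mono power_mono \<nu>)
      have "1 \<le> (1 + 2 * \<rho>) * (1 - \<rho>)"
        using \<rho> mult_left_mono[of "2 * \<rho>" 1 \<rho>] by (simp add: algebra_simps)
      then have "1 / (1 - \<rho>) \<le> 1 + 2 * \<rho>" using \<rho> by (simp add: field_simps)
      then show "1 / (1 - \<rho>) \<le> 1 + \<eta> / 2" using \<rho> by simp
    qed auto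
    finally have "?D * N + 1 \<le> real N ^ m * (1 + \<eta> / 2) + N * (\<rho> * N) ^ m + 1" by simp
    also have "\<dots> = real N ^ m * (1 + \<eta> / 2 + (real N * \<rho> ^ m + (1 / real N) ^ m))"
      using N1 by (simp add: algebra_simps power_mult_distrib power_one_over)
    also have "\<dots> \<le> real N ^ m * (1 + \<eta>)"
      using m0[OF m] by (intro mult_left_mono) auto
    finally show ?thesis by (simp add: mult.commute)
  qed
  show ?thesis
  proof (rule that[of b m0])
    show "1 / real (2 ^ b - 1 :: nat) \<le> \<eta>" using \<rho> \<eta> by (intro order_trans[OF b(2)]) linarith
    show "real (card (directions (int (2 ^ b - 1)) m) * (2 ^ b - 1) + 1)
       \<le> (1 + \<eta>) * real (2 ^ b - 1 :: nat) ^ m" if "m \<ge> m0" for m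
      using main[OF that] unfolding N_def .
  qed (fact b)
qed

lemma cov_num_double_iterate:
  fixes X :: real
  assumes "real (cov_num n 1) * X \<le> 2 ^ n" and X: "X \<ge> 0"
  shows "real (cov_num (2 ^ j * (n + 1) - 1) 1) * (2 ^ j * X) \<le> 2 ^ (2 ^ j * (n + 1) - 1)"
proof (induction j)
  case 0
  then show ?case using assms by simp
next
  case (Suc j)
  define k :: nat where "k = 2 ^ j * (n + 1) - 1"
  note IH = Suc[folded k_def]
  have "2 ^ j * (n + 1) > (0::nat)" by simp
  then have e: "2 ^ Suc j * (n + 1) - 1 = 2 * k + 1" unfolding k_def power_Suc mult.assoc by linarith
  have "real (cov_num (2 * k + 1) 1) \<le> real (2 ^ k * cov_num k 1)"
    by (intro of_nat_mono cov_num_double)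
  then have "real (cov_num (2 * k + 1) 1) * (2 ^ Suc j * X)
      \<le> real (2 ^ k * cov_num k 1) * (2 ^ Suc j * X)"
    using X by (intro mult_right_mono) auto
  also have "\<dots> = 2 * 2 ^ k * (real (cov_num k 1) * (2 ^ j * X))" by simp
  also have "\<dots> \<le> 2 * 2 ^ k * 2 ^ k" by (intro mult_left_mono IH) simp
  also have "2 * 2 ^ k * 2 ^ k = (2::real) ^ (2 * k + 1)"
  proof -
    have "2 * k + 1 = Suc (k + k)" by simp
    then show ?thesis by (simp only: power_Suc power_add mult.assoc)
  qed
  finally show ?case unfolding e .
qed

lemma cov_num_pad_density:
  fixes X :: real
  assumes "real (cov_num n r) * X \<le> 2 ^ n" and X: "X \<ge> 0" and "n \<le> n'"
  shows "real (cov_num n' r) * X \<le> 2 ^ n'"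
proof -
  have "cov_num n' r \<le> 2 ^ (n' - n) * cov_num n r" using cov_num_pad[of "n' - n" n r] assms by simp
  then have "real (cov_num n' r) \<le> 2 ^ (n' - n) * real (cov_num n r)"
    using of_nat_mono[where 'a = real] by fastforce
  then have "real (cov_num n' r) * X \<le> 2 ^ (n' - n) * real (cov_num n r) * X"
    using X by (rule mult_right_mono)
  then have "real (cov_num n' r) * X \<le> 2 ^ (n' - n) * (real (cov_num n r) * X)"
    by (simp only: mult.assoc)
  also have "\<dots> \<le> 2 ^ (n' - n) * 2 ^ n" by (intro mult_left_mono assms) simp
  also have "\<dots> = 2 ^ n'" using assms by (simp flip: power_add)
  finally show ?thesis .
qed

text \<open>Replacing a factor \<open>2^b\<close> by \<open>N = 2^b - 1\<close> shrinks a product by the factor \<open>1 + 1 / N\<close>. Starting from the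
  first \<open>2^k N^m0\<close> above \<open>T\<close>, at most a bounded number of such replacements are needed to come down to
  \<open>T\<close>, and the last one overshoots by no more than that factor.\<close>

lemma products_of_powers_dense:
  fixes N b m0 :: nat
  assumes N: "N + 1 = 2 ^ b" "N > 0"
  obtains T0 :: real where "\<And>T. T \<ge> T0 \<Longrightarrow>
    \<exists>j m. m0 \<le> m \<and> 2 ^ j * real N ^ m \<le> T \<and> T < (1 + 1 / N) * (2 ^ j * real N ^ m)"
proof -
  define q where "q = real N / 2 ^ b"
  have Nb: "real N + 1 = 2 ^ b" using N(1) by (metis of_nat_1 of_nat_add of_nat_numeral of_nat_power)
  have q: "0 < q" "q < 1" "1 / q = 1 + 1 / N" using N(2) Nb[symmetric] by (auto simp: q_def field_simps)
  obtain i1 where i1: "q ^ i1 < 1 / 2" using real_arch_pow_inv[of "1/2" q] q by auto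
  show ?thesis
  proof (rule that[of "2 ^ (b * i1) * real N ^ m0"])
    fix T :: real assume T: "2 ^ (b * i1) * real N ^ m0 \<le> T"
    have Npos: "real N ^ m0 > 0" using N by simp
    have T1: "real N ^ m0 \<le> T"
    proof -
      have "1 * real N ^ m0 \<le> 2 ^ (b * i1) * real N ^ m0" by (intro mult_right_mono) auto
      then show ?thesis using T by linarith
    qed
    define k where "k = (LEAST k. T < 2 ^ k * real N ^ m0)"
    have "\<exists>k. T / real N ^ m0 < 2 ^ k" by (rule real_arch_pow) simp
    then have "\<exists>k. T < 2 ^ k * real N ^ m0" using Npos by (simp add: pos_divide_less_eq)
    then have k: "T < 2 ^ k * real N ^ m0" unfolding k_def by (rule LeastI_ex)
    have "k \<noteq> 0" using k T1 by (intro notI) auto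
    then have "\<not> T < 2 ^ (k - 1) * real N ^ m0" unfolding k_def by (intro not_less_Least) simp
    moreover have "2 ^ k = 2 * (2::real) ^ (k - 1)" using \<open>k \<noteq> 0\<close> by (metis power_eq_if)
    ultimately have k': "2 ^ k * real N ^ m0 \<le> 2 * T" by simp
    have "2 ^ (b * i1) * real N ^ m0 < 2 ^ k * real N ^ m0" using T k by linarith
    then have bk: "b * i1 < k" using Npos by simp
    define V where "V = 2 ^ k * real N ^ m0"
    define i where "i = (LEAST i. V * q ^ i \<le> T)"
    have "V * q ^ i1 \<le> 2 * T * q ^ i1" using k' q by (intro mult_right_mono) (auto simp: V_def)
    also have "\<dots> \<le> 2 * T * (1 / 2)" using i1 T1 Npos by (intro mult_left_mono) linarith+
    finally have w: "V * q ^ i1 \<le> T" by simp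
    then have i: "V * q ^ i \<le> T" "i \<le> i1" unfolding i_def by (rule LeastI, rule Least_le)
    have "i \<noteq> 0" using i k by (intro notI) (auto simp: V_def)
    then have "\<not> V * q ^ (i - 1) \<le> T" unfolding i_def by (intro not_less_Least) simp
    then have "T < V * q ^ (i - 1)" by simp
    also have "q ^ (i - 1) = 1 / q * q ^ i"
    proof -
      have "q ^ i = q * q ^ (i - 1)" using \<open>i \<noteq> 0\<close> by (simp flip: power_Suc)
      then show ?thesis using q(1) by (simp only: field_simps) simp
    qed
    finally have up: "T < (1 + 1 / N) * (V * q ^ i)" unfolding q(3) by (simp only: ac_simps)
    have "b * i \<le> k" using i(2) bk by (meson less_imp_le mult_le_mono2 order_trans)
    then have "(2::real) ^ k = 2 ^ (k - b * i) * (2 ^ b) ^ i" by (simp flip: power_add power_mult)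
    then have "V * q ^ i = 2 ^ (k - b * i) * real N ^ (m0 + i)"
      by (simp add: V_def q_def power_divide power_add)
    then show "\<exists>j m. m0 \<le> m \<and> 2 ^ j * real N ^ m \<le> T \<and> T < (1 + 1 / N) * (2 ^ j * real N ^ m)"
      using i(1) up by (intro exI[of _ "k - b * i"] exI[of _ "m0 + i"]) auto
  qed
qed

text \<open>For a given length choose \<open>2^j N^m\<close> just below it. The cyclic code of index \<open>N^m\<close>, doubled \<open>j\<close> times
  and extended by free coordinates up to the given length, has index \<open>2^j N^m\<close>.\<close>

theorem radius_one_density:
  fixes \<eta> :: real
  assumes \<eta>: "\<eta> > 0"
  shows "\<forall>\<^sub>F n in sequentially. real (cov_num n 1) * real n \<le> (1 + \<eta>) * 2 ^ n"
proof -
  \<comment> \<open>small enough for \<open>(1 + \<theta>)^2 \<le> 1 + \<eta>\<close>: one factor is lost in the length of the cyclic code, one in its index\<close>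
  define \<theta> where "\<theta> = min 1 (\<eta> / 3)"
  have \<theta>: "0 < \<theta>" "\<theta> \<le> 1" "3 * \<theta> \<le> \<eta>" using \<eta> by (auto simp: \<theta>_def)
  have \<theta>2: "(1 + \<theta>) * (1 + \<theta>) \<le> 1 + \<eta>"
  proof -
    have "\<theta> * \<theta> \<le> \<theta> * 1" using \<theta> by (intro mult_left_mono) auto
    then have "1 + 2 * \<theta> + \<theta> * \<theta> \<le> 1 + \<eta>" using \<theta>(3) by linarith
    then show ?thesis by (simp add: algebra_simps)
  qed
  obtain b m0 where b: "(2 ^ b - 1 :: nat) > 1" "1 / real (2 ^ b - 1 :: nat) \<le> \<theta>"
    "\<And>m. m \<ge> m0 \<Longrightarrow> real (card (directions (int (2 ^ b - 1)) m) * (2 ^ b - 1) + 1)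
       \<le> (1 + \<theta>) * real (2 ^ b - 1 :: nat) ^ m"
    using short_cyclic_codes[OF \<theta>(1)] by blast
  define N :: nat where "N = 2 ^ b - 1"
  have N1: "N > 1" and N2: "1 / real N \<le> \<theta>" using b by (simp_all add: N_def)
  have Nb: "N + 1 = 2 ^ b" by (simp add: N_def)
  have intN: "int N = 2 ^ b - 1" by (simp add: N_def of_nat_diff)
  obtain T0 where T0: "\<And>T. T \<ge> T0 \<Longrightarrow>
      \<exists>j m. m0 \<le> m \<and> 2 ^ j * real N ^ m \<le> T \<and> T < (1 + 1 / N) * (2 ^ j * real N ^ m)"
    using products_of_powers_dense[OF Nb, of m0] N1 by auto
  obtain n0 :: nat where n0: "(1 + \<theta>) * T0 \<le> n0" using real_arch_simple by blast
  show ?thesis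
    unfolding eventually_sequentially
  proof (intro exI[of _ n0] allI impI)
    fix n assume n: "n \<ge> n0"
    \<comment> \<open>an index of at most \<open>T\<close> keeps the length within \<open>n\<close>\<close>
    define T where "T = (real n + 1) / (1 + \<theta>)"
    have Tn: "T * (1 + \<theta>) = real n + 1" using \<theta> by (simp add: T_def)
    have "T \<ge> T0" using n0 n \<theta> by (simp add: T_def field_simps)
    then obtain j m where jm: "m0 \<le> m" "2 ^ j * real N ^ m \<le> T"
      "T < (1 + 1 / N) * (2 ^ j * real N ^ m)" using T0 by blast
    define l where "l = card (directions (int N) m) * N"
    have l: "real (l + 1) \<le> (1 + \<theta>) * real N ^ m"
      using b(3)[OF jm(1)] intN by (simp add: l_def N_def)
    define X where "X = real N ^ m"
    have X: "X \<ge> 0" by (simp add: X_def)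
    have "N ^ m * cov_num l 1 \<le> 2 ^ l"
      using cov_num_cyclic[of b m] N1 by (simp add: l_def N_def)
    then have "real (cov_num l 1) * X \<le> 2 ^ l"
      unfolding X_def by (metis mult.commute of_nat_le_iff of_nat_mult of_nat_numeral of_nat_power)
    then have c: "real (cov_num (2 ^ j * (l + 1) - 1) 1) * (2 ^ j * X) \<le> 2 ^ (2 ^ j * (l + 1) - 1)"
      using X by (rule cov_num_double_iterate)
    have "real (2 ^ j * (l + 1)) = 2 ^ j * real (l + 1)" by (simp only: of_nat_mult of_nat_power of_nat_numeral)
    also have "\<dots> \<le> 2 ^ j * ((1 + \<theta>) * X)" using l by (intro mult_left_mono) (simp_all add: X_def)
    also have "\<dots> = (2 ^ j * X) * (1 + \<theta>)" by simp
    also have "\<dots> \<le> T * (1 + \<theta>)" using jm \<theta> by (intro mult_right_mono) (auto simp: X_def)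
    also have "\<dots> = real (n + 1)" using Tn by simp
    finally have "2 ^ j * (l + 1) \<le> n + 1" by (simp only: of_nat_le_iff)
    then have "2 ^ j * (l + 1) - 1 \<le> n" by linarith
    then have cn: "real (cov_num n 1) * (2 ^ j * X) \<le> 2 ^ n"
      using cov_num_pad_density[OF c] X by simp
    have "real n \<le> T * (1 + \<theta>)" using Tn by simp
    also have "\<dots> \<le> ((1 + \<theta>) * (2 ^ j * X)) * (1 + \<theta>)"
    proof (intro mult_right_mono)
      have "(1 + 1 / N) * (2 ^ j * X) \<le> (1 + \<theta>) * (2 ^ j * X)"
        using N2 X by (intro mult_right_mono) auto
      then show "T \<le> (1 + \<theta>) * (2 ^ j * X)" using jm(3)[folded X_def] by linarith
    qed (use \<theta> in auto)
    also have "\<dots> = ((1 + \<theta>) * (1 + \<theta>)) * (2 ^ j * X)" by simp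
    also have "\<dots> \<le> (1 + \<eta>) * (2 ^ j * X)" using \<theta>2 X by (intro mult_right_mono) auto
    finally have "real (cov_num n 1) * real n \<le> real (cov_num n 1) * ((1 + \<eta>) * (2 ^ j * X))"
      by (intro mult_left_mono) auto
    also have "\<dots> = (1 + \<eta>) * (real (cov_num n 1) * (2 ^ j * X))" by simp
    also have "\<dots> \<le> (1 + \<eta>) * 2 ^ n" using cn \<eta> by (intro mult_left_mono) auto
    finally show "real (cov_num n 1) * real n \<le> (1 + \<eta>) * 2 ^ n" .
  qed
qed

section \<open>Greedy partial codes\<close>

lemma card_ball:
  assumes I: "finite I" and c: "c \<subseteq> I"
  shows "card {y. y \<subseteq> I \<and> card (sym_diff y c) \<le> r} = binomial_le (card I) r"
proof -
  have "bij_betw (\<lambda>y. sym_diff y c) {y. y \<subseteq> I \<and> card (sym_diff y c) \<le> r} {z. z \<subseteq> I \<and> card z \<le> r}"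
  proof (rule bij_betw_byWitness[where f' = "\<lambda>z. sym_diff z c"])
    have e: "sym_diff (sym_diff y c) c = y" for y by auto
    show "\<forall>a\<in>{y. y \<subseteq> I \<and> card (sym_diff y c) \<le> r}. sym_diff (sym_diff a c) c = a"
      by (intro ballI e)
    show "\<forall>a\<in>{z. z \<subseteq> I \<and> card z \<le> r}. sym_diff (sym_diff a c) c = a" by (intro ballI e)
    show "(\<lambda>y. sym_diff y c) ` {y. y \<subseteq> I \<and> card (sym_diff y c) \<le> r} \<subseteq> {z. z \<subseteq> I \<and> card z \<le> r}"
      using c by auto
    show "(\<lambda>z. sym_diff z c) ` {z. z \<subseteq> I \<and> card z \<le> r} \<subseteq> {y. y \<subseteq> I \<and> card (sym_diff y c) \<le> r}"
    proof
      fix y assume "y \<in> (\<lambda>z. sym_diff z c) ` {z. z \<subseteq> I \<and> card z \<le> r}"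
      then obtain z where z: "z \<subseteq> I" "card z \<le> r" "y = sym_diff z c" by blast
      have "sym_diff y c = z" unfolding z(3) by (rule e)
      moreover have "y \<subseteq> I" using z c by blast
      ultimately show "y \<in> {y. y \<subseteq> I \<and> card (sym_diff y c) \<le> r}" using z(2) by simp
    qed
  qed
  then have "card {y. y \<subseteq> I \<and> card (sym_diff y c) \<le> r} = card {z. z \<subseteq> I \<and> card z \<le> r}"
    by (rule bij_betw_same_card)
  also have "{z. z \<subseteq> I \<and> card z \<le> r} = (\<Union>i\<in>{0..r}. {z. z \<subseteq> I \<and> card z = i})" by auto
  also have "card \<dots> = (\<Sum>i\<in>{0..r}. card {z. z \<subseteq> I \<and> card z = i})"
    using I by (intro card_UN_disjoint) auto
  also have "\<dots> = binomial_le (card I) r"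
    unfolding binomial_le_def by (intro sum.cong refl n_subsets I)
  finally show ?thesis .
qed

lemma binomial_le_pos: "binomial_le n r > 0"
proof -
  have "(n choose 0) \<le> binomial_le n r" unfolding binomial_le_def by (rule member_le_sum) auto
  then show ?thesis by simp
qed

lemma binomial_le_le_pow: "binomial_le n r \<le> 2 ^ n"
proof -
  have "card {y. y \<subseteq> {..<n} \<and> card (sym_diff y {}) \<le> r} \<le> card (Pow {..<n})"
    by (intro card_mono) auto
  then show ?thesis using card_ball[of "{..<n}" "{}" r] by (simp add: card_Pow)
qed

text \<open>The sphere-covering bound.\<close>

lemma covers_card_ge:
  assumes I: "finite I" "card I = n" and C: "covers I r C"
  shows "2 ^ n \<le> card C * binomial_le n r"
proof -
  have sub: "C \<subseteq> Pow I" using C by (simp add: covers_def)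
  let ?ball = "\<lambda>c. {y. y \<subseteq> I \<and> card (sym_diff y c) \<le> r}"
  have "Pow I \<subseteq> (\<Union>c\<in>C. ?ball c)"
    using C unfolding covers_def near_def by blast
  then have "card (Pow I) \<le> card (\<Union>c\<in>C. ?ball c)"
    using I(1) covers_finite[OF I(1) C] by (intro card_mono) auto
  also have "\<dots> \<le> (\<Sum>c\<in>C. card (?ball c))"
    by (rule card_UN_le[OF covers_finite[OF I(1) C]])
  finally have "2 ^ n \<le> (\<Sum>c\<in>C. card (?ball c))"
    using I by (simp add: card_Pow)
  also have "\<dots> = (\<Sum>c\<in>C. binomial_le n r)"
  proof (rule sum.cong[OF refl])
    fix c assume "c \<in> C"
    then have "c \<subseteq> I" using sub by blast
    then show "card (?ball c) = binomial_le n r" using card_ball[OF I(1)] I(2) by blast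
  qed
  finally show ?thesis by simp
qed

text \<open>Let \<open>V\<close> be the volume of a ball. Averaging over all centres, some ball contains at least the proportion \<open>V / 2^m\<close> of the words that
  are still uncovered. Adding its centre multiplies their number by at most \<open>1 - V / 2^m\<close>.\<close>

lemma greedy_partial_code:
  "\<exists>B \<subseteq> Pow {..<m}. card B \<le> K \<and>
     real (card {y. y \<subseteq> {..<m} \<and> \<not> near r B y}) \<le> 2 ^ m * (1 - real (binomial_le m r) / 2 ^ m) ^ K"
proof (induction K)
  case 0
  have "{y. y \<subseteq> {..<m} \<and> \<not> near r {} y} = Pow {..<m}" by (auto simp: near_def)
  then show ?case by (intro exI[of _ "{}"]) (simp add: card_Pow)
next
  case (Suc K)
  let ?I = "{..<m}" and ?V = "real (binomial_le m r)"
  define U where "U B = {y. y \<subseteq> ?I \<and> \<not> near r B y}" for B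
  obtain B where B: "B \<subseteq> Pow ?I" "card B \<le> K" "real (card (U B)) \<le> 2 ^ m * (1 - ?V / 2 ^ m) ^ K"
    using Suc unfolding U_def by blast
  have finU: "finite (U B)" by (simp add: U_def)
  let ?ball = "\<lambda>c. {y \<in> U B. card (sym_diff y c) \<le> r}"
  have "(\<Sum>c\<in>Pow ?I. card (?ball c)) = (\<Sum>c\<in>Pow ?I. \<Sum>y\<in>U B. if card (sym_diff y c) \<le> r then 1 else 0)"
    using finU by (simp add: sum.If_cases Int_def)
  also have "\<dots> = (\<Sum>y\<in>U B. \<Sum>c\<in>Pow ?I. if card (sym_diff y c) \<le> r then 1 else 0)"
    by (rule sum.swap)
  also have "\<dots> = (\<Sum>y\<in>U B. binomial_le m r)"
  proof (rule sum.cong[OF refl])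
    fix y assume "y \<in> U B"
    then have y: "y \<subseteq> ?I" by (simp add: U_def)
    have "(\<Sum>c\<in>Pow ?I. if card (sym_diff y c) \<le> r then 1 else 0)
        = card {c. c \<subseteq> ?I \<and> card (sym_diff c y) \<le> r}"
      by (simp add: sum.If_cases Int_def Un_commute)
    then show "(\<Sum>c\<in>Pow ?I. if card (sym_diff y c) \<le> r then 1 else 0) = binomial_le m r"
      using card_ball[OF _ y, of r] by simp
  qed
  finally have avg: "(\<Sum>c\<in>Pow ?I. card (?ball c)) = card (U B) * binomial_le m r" by simp
  have "\<exists>c\<in>Pow ?I. real (card (U B)) * ?V / 2 ^ m \<le> card (?ball c)"
  proof (rule ccontr)
    assume "\<not> ?thesis"
    then have "(\<Sum>c\<in>Pow ?I. real (card (?ball c))) < (\<Sum>c\<in>Pow ?I. real (card (U B)) * ?V / 2 ^ m)"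
      by (intro sum_strict_mono) (auto simp: not_le)
    also have "\<dots> = real (card (U B)) * ?V" by (simp add: card_Pow)
    finally show False using arg_cong[OF avg, of real] by simp
  qed
  then obtain c where c: "c \<subseteq> ?I" "real (card (U B)) * ?V / 2 ^ m \<le> card (?ball c)" by blast
  have "U (insert c B) = U B - ?ball c" by (auto simp: U_def near_def)
  then have "card (U (insert c B)) = card (U B) - card (?ball c)"
    using finU by (simp add: card_Diff_subset)
  moreover have "card (?ball c) \<le> card (U B)" using finU by (intro card_mono) auto
  ultimately have "real (card (U (insert c B))) = real (card (U B)) - card (?ball c)"
    by (simp add: of_nat_diff)
  also have "\<dots> \<le> real (card (U B)) * (1 - ?V / 2 ^ m)" using c by (simp add: algebra_simps)
  also have "\<dots> \<le> 2 ^ m * (1 - ?V / 2 ^ m) ^ K * (1 - ?V / 2 ^ m)"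
  proof (rule mult_right_mono[OF B(3)])
    have "?V \<le> 2 ^ m" using binomial_le_le_pow[of m r]
      by (metis of_nat_le_iff of_nat_numeral of_nat_power)
    then show "0 \<le> 1 - ?V / 2 ^ m" by simp
  qed
  finally have "real (card (U (insert c B))) \<le> 2 ^ m * (1 - ?V / 2 ^ m) ^ Suc K" by (simp add: mult_ac)
  moreover have "card (insert c B) \<le> Suc K"
    using B(2) card_insert_le_m1[of "Suc K" B c] by simp
  ultimately show ?case
    using B(1) c(1) unfolding U_def by (intro exI[of _ "insert c B"]) simp
qed

section \<open>The recursive inequality\<close>

definition cov_density :: "nat \<Rightarrow> nat \<Rightarrow> real" where
  "cov_density n r = real (cov_num n r) * real (binomial_le n r) / 2 ^ n"

text \<open>The bound of \<open>cov_num_partial_sum\<close> for a greedy partial code with \<open>\<lceil>\<delta> 2^m / V\<rceil>\<close> codewords, written as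
  a product of the density of codes of radius 1 and of quotients whose limits are easy to
  determine. The term \<open>V / 2^m\<close> comes from rounding up the number of codewords.\<close>

lemma cov_density_recursion:
  fixes \<delta> :: real
  assumes \<delta>: "\<delta> > 0" and n: "n > 0"
  shows "cov_density (m + n) (r + 1)
    \<le> (real (cov_num n 1) * n / 2 ^ n) * (\<delta> + real (binomial_le m r) / 2 ^ m)
        * (real (binomial_le (m + n) (r + 1)) / (real (binomial_le m r) * n))
      + exp (- \<delta>) * (real (binomial_le (m + n) (r + 1)) / real (binomial_le n (r + 1)))
        * cov_density n (r + 1)"
proof -
  define V where "V = real (binomial_le m r)"
  define W where "W = real (binomial_le n (r + 1))"
  define Z where "Z = real (binomial_le (m + n) (r + 1))"
  have pos: "V > 0" "W > 0" "Z > 0" using binomial_le_pos by (simp_all add: V_def W_def Z_def)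
  have Vle: "V \<le> 2 ^ m" unfolding V_def using binomial_le_le_pow[of m r]
    by (metis of_nat_le_iff of_nat_numeral of_nat_power)
  define K where "K = nat \<lceil>\<delta> * 2 ^ m / V\<rceil>"
  have x0: "0 \<le> \<delta> * 2 ^ m / V" using \<delta> pos by simp
  have K: "\<delta> * 2 ^ m / V \<le> K" "K \<le> \<delta> * 2 ^ m / V + 1"
    unfolding K_def using x0 by linarith+
  obtain B where B: "B \<subseteq> Pow {..<m}" "card B \<le> K"
    "real (card {y. y \<subseteq> {..<m} \<and> \<not> near r B y}) \<le> 2 ^ m * (1 - V / 2 ^ m) ^ K"
    unfolding V_def using greedy_partial_code by blast
  define U where "U = {y. y \<subseteq> {..<m} \<and> \<not> near r B y}"
  have "(1 - V / 2 ^ m) ^ K \<le> exp (- (V / 2 ^ m)) ^ K"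
    using Vle exp_ge_add_one_self[of "- (V / 2 ^ m)"] by (intro power_mono) auto
  also have "\<dots> = exp (- (K * (V / 2 ^ m)))" by (simp flip: exp_of_nat_mult)
  also have "\<dots> \<le> exp (- \<delta>)" using K(1) pos by (simp add: field_simps)
  finally have "2 ^ m * (1 - V / 2 ^ m) ^ K \<le> 2 ^ m * exp (- \<delta>)" by (intro mult_left_mono) auto
  with B(3) have cU: "real (card U) \<le> 2 ^ m * exp (- \<delta>)" unfolding U_def by (rule order_trans)
  have "cov_num (m + n) (r + 1) \<le> card B * cov_num n 1 + card U * cov_num n (r + 1)"
    using cov_num_partial_sum[OF B(1) U_def] .
  then have "real (cov_num (m + n) (r + 1)) \<le> real (card B) * cov_num n 1 + real (card U) * cov_num n (r + 1)"
    by (metis of_nat_add of_nat_le_iff of_nat_mult)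
  also have "\<dots> \<le> (\<delta> * 2 ^ m / V + 1) * cov_num n 1 + 2 ^ m * exp (- \<delta>) * cov_num n (r + 1)"
    using B(2) K(2) cU by (intro add_mono mult_right_mono) auto
  finally have "cov_density (m + n) (r + 1)
     \<le> ((\<delta> * 2 ^ m / V + 1) * cov_num n 1 + 2 ^ m * exp (- \<delta>) * cov_num n (r + 1)) * Z / 2 ^ (m + n)"
    unfolding cov_density_def Z_def[symmetric] using pos by (intro divide_right_mono mult_right_mono) auto
  also have "\<dots> = (real (cov_num n 1) * n / 2 ^ n) * (\<delta> + V / 2 ^ m) * (Z / (V * n))
      + exp (- \<delta>) * (Z / W) * (cov_num n (r + 1) * W / 2 ^ n)"
  proof -
    have id: "((\<delta> * P / V + 1) * c + P * t * d) * Z / (P * Q)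
        = (c * x / Q) * (\<delta> + V / P) * (Z / (V * x)) + t * (Z / W) * (d * W / Q)"
      if "P > 0" "Q > 0" "x > 0" for P Q x c d t :: real
    proof -
      have "((\<delta> * P / V + 1) * c + P * t * d) * Z / (P * Q)
          = (\<delta> * P / V + 1) / P * c * Z / Q + t * d * Z / Q"
        using that by (simp add: add_divide_distrib distrib_right)
      also have "(\<delta> * P / V + 1) / P = (\<delta> + V / P) / V"
        using that pos by (simp add: add_divide_distrib)
      finally show ?thesis using that pos by (simp add: ac_simps)
    qed
    have P: "(2::real) ^ m > 0" "(2::real) ^ n > 0" "real n > 0" using n by simp_all
    show ?thesis unfolding power_add[of 2 m n] by (rule id[OF P])
  qed
  finally show ?thesis unfolding V_def W_def Z_def cov_density_def[of n] .
qed

lemma binomial_over_power: "(\<lambda>n. real (n choose k) / real n ^ k) \<longlonglongrightarrow> 1 / fact k"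
proof (induction k)
  case 0
  then show ?case by simp
next
  case (Suc k)
  have "(\<lambda>n. real (n choose k) / real n ^ k * (1 - real k * inverse (real n)) / Suc k)
      \<longlonglongrightarrow> 1 / fact k * (1 - real k * 0) / Suc k"
    by (intro tendsto_divide tendsto_mult[OF Suc] tendsto_diff tendsto_mult[OF tendsto_const]
        tendsto_const lim_inverse_n) simp
  moreover have "\<forall>\<^sub>F n in sequentially.
      real (n choose k) / real n ^ k * (1 - real k * inverse (real n)) / Suc k
      = real (n choose Suc k) / real n ^ Suc k"
    using eventually_gt_at_top[of k]
  proof eventually_elim
    case (elim n)
    have "Suc k * (n choose Suc k) = (n - k) * (n choose k)"
      by (metis binomial_absorb_comp binomial_absorption)
    then have "real (Suc k) * real (n choose Suc k) = (real n - real k) * real (n choose k)"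
      using elim by (metis less_imp_le of_nat_diff of_nat_mult)
    then have e: "real (n choose Suc k) = (real n - real k) * real (n choose k) / real (Suc k)"
      by (simp only: eq_divide_eq mult.commute) simp
    have "1 - real k * inverse (real n) = (real n - real k) / real n"
      using elim by (simp add: divide_inverse left_diff_distrib)
    then show ?case unfolding e power_Suc by (simp only: divide_inverse inverse_mult_distrib mult_ac)
  qed
  ultimately have "(\<lambda>n. real (n choose Suc k) / real n ^ Suc k)
      \<longlonglongrightarrow> 1 / fact k * (1 - real k * 0) / Suc k"
    by (rule Lim_transform_eventually)
  then show ?case by (simp add: field_simps)
qed

lemma binomial_le_over_power: "(\<lambda>n. real (binomial_le n r) / real n ^ r) \<longlonglongrightarrow> 1 / fact r"
proof (induction r)
  case 0
  then show ?case by (simp add: binomial_le_def)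
next
  case (Suc r)
  have "(\<lambda>n. real (binomial_le n r) / real n ^ r * inverse (real n) + real (n choose Suc r) / real n ^ Suc r)
     \<longlonglongrightarrow> 1 / fact r * 0 + 1 / fact (Suc r)"
    by (intro tendsto_add tendsto_mult[OF Suc lim_inverse_n] binomial_over_power)
  moreover have "real (binomial_le n r) / real n ^ r * inverse (real n) + real (n choose Suc r) / real n ^ Suc r
      = real (binomial_le n (Suc r)) / real n ^ Suc r" for n
    by (simp add: binomial_le_def add_divide_distrib divide_inverse mult_ac distrib_left)
  ultimately show ?case by simp
qed

lemma div_over_self:
  assumes "R > 0" shows "(\<lambda>N. real (N div R) / real N) \<longlonglongrightarrow> 1 / real R"
proof (rule tendsto_sandwich)
  show "(\<lambda>N. 1 / real R - inverse (real N)) \<longlonglongrightarrow> 1 / real R"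
    using tendsto_diff[OF tendsto_const lim_inverse_n] by fastforce
  show "\<forall>\<^sub>F N in sequentially. 1 / real R - inverse (real N) \<le> real (N div R) / real N"
    using eventually_gt_at_top[of 0]
  proof eventually_elim
    case (elim N)
    have "real (N div R) = of_int \<lfloor>real N / real R\<rfloor>" by (simp add: floor_divide_of_nat_eq)
    then have "real N / R - 1 \<le> real (N div R)" by linarith
    then have "(real N / R - 1) / N \<le> real (N div R) / N" by (rule divide_right_mono) simp
    moreover have "(real N / R - 1) / N = 1 / real R - inverse (real N)"
      using elim by (simp add: diff_divide_distrib inverse_eq_divide)
    ultimately show ?case by linarith
  qed
  show "\<forall>\<^sub>F N in sequentially. real (N div R) / real N \<le> 1 / real R"
    using eventually_gt_at_top[of 0]
  proof eventually_elim
    case (elim N)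
    have "real (N div R) / N \<le> real N / R / N" by (rule divide_right_mono[OF of_nat_div_le_of_nat]) simp
    then show ?case using elim by simp
  qed
qed simp

lemma filterlim_div: 
  assumes "R > 0" shows "filterlim (\<lambda>N::nat. N div R) at_top at_top"
  unfolding filterlim_at_top eventually_sequentially
proof (intro allI)
  fix Z :: nat
  have "Z \<le> n div R" if "Z * R \<le> n" for n
    using div_le_mono[OF that, of R] assms by simp
  then show "\<exists>N. \<forall>n\<ge>N. Z \<le> n div R" by blast
qed

section \<open>The limit of the recursion\<close>

text \<open>The difference \<open>h\<close> between \<open>g\<close> and the fixed point \<open>A / (1 - \<kappa>)\<close> satisfies \<open>h n \<le> \<kappa> h (n div R)\<close> for
  large \<open>n\<close>. Hence \<open>h\<close> is bounded above, and the bound improves by the factor \<open>\<kappa>\<close> each time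
  the recursion is applied. Boundedness of \<open>g\<close> comes out of the recursion.\<close>

lemma eventually_le_contraction_limit:
  fixes g :: "nat \<Rightarrow> real"
  assumes R: "R \<ge> 2" and \<kappa>: "0 \<le> \<kappa>" "\<kappa> < 1" and \<epsilon>: "\<epsilon> > 0"
    and rec: "\<forall>\<^sub>F n in sequentially. g n \<le> A + \<kappa> * g (n div R)"
  shows "\<forall>\<^sub>F n in sequentially. g n \<le> A / (1 - \<kappa>) + \<epsilon>"
proof -
  define h where "h n = g n - A / (1 - \<kappa>)" for n
  have fix_eq: "A + \<kappa> * (A / (1 - \<kappa>)) = A / (1 - \<kappa>)" using \<kappa> by (simp add: field_simps)
  obtain n0 where n0: "\<And>n. n \<ge> n0 \<Longrightarrow> g n \<le> A + \<kappa> * g (n div R)"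
    using rec by (auto simp: eventually_sequentially)
  have h: "h n \<le> \<kappa> * h (n div R)" if "n \<ge> n0" for n
  proof -
    have "\<kappa> * h (n div R) = \<kappa> * g (n div R) - \<kappa> * (A / (1 - \<kappa>))"
      unfolding h_def by (rule right_diff_distrib)
    then show ?thesis using n0[OF that] fix_eq unfolding h_def by linarith
  qed
  \<comment> \<open>\<open>n div R < n\<close>, so a bound on the initial segment propagates\<close>
  define H where "H = Max (insert 0 (h ` {..n0}))"
  have H0: "H \<ge> 0" unfolding H_def by (rule Max_ge) auto
  have hH: "h n \<le> H" for n
  proof (induction n rule: less_induct)
    case (less n)
    show ?case
    proof (cases "n \<le> n0")
      case True
      then show ?thesis unfolding H_def by (intro Max_ge) auto
    next
      case False
      then have "h n \<le> \<kappa> * h (n div R)" using h by simp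
      also have "\<dots> \<le> \<kappa> * H" using less[of "n div R"] False R \<kappa> by (intro mult_left_mono) auto
      also have "\<dots> \<le> 1 * H" using \<kappa> H0 by (intro mult_right_mono) auto
      finally show ?thesis by simp
    qed
  qed
  have iter: "\<exists>N. \<forall>n\<ge>N. h n \<le> \<kappa> ^ k * H" for k
  proof (induction k)
    case 0
    then show ?case using hH by auto
  next
    case (Suc k)
    then obtain N where N: "\<And>n. n \<ge> N \<Longrightarrow> h n \<le> \<kappa> ^ k * H" by blast
    show ?case
    proof (intro exI[of _ "max n0 (N * R)"] allI impI)
      fix n assume n: "max n0 (N * R) \<le> n"
      have "N \<le> n div R" using div_le_mono[of "N * R" n R] n R by simp
      then have "\<kappa> * h (n div R) \<le> \<kappa> * (\<kappa> ^ k * H)" using N \<kappa> by (intro mult_left_mono) auto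
      then show "h n \<le> \<kappa> ^ Suc k * H" using h[of n] n by simp
    qed
  qed
  have "(\<lambda>k. \<kappa> ^ k * H) \<longlonglongrightarrow> 0 * H"
    using \<kappa> by (intro tendsto_mult tendsto_const LIMSEQ_power_zero) simp
  then have "\<forall>\<^sub>F k in sequentially. \<kappa> ^ k * H < \<epsilon>" using \<epsilon> by (intro order_tendstoD) auto
  then obtain k where k: "\<kappa> ^ k * H < \<epsilon>" by (auto simp: eventually_sequentially)
  obtain N where N: "\<And>n. n \<ge> N \<Longrightarrow> h n \<le> \<kappa> ^ k * H" using iter by blast
  show ?thesis
    unfolding eventually_sequentially
  proof (intro exI[of _ N] allI impI)
    fix n assume "N \<le> n"
    then show "g n \<le> A / (1 - \<kappa>) + \<epsilon>" using N[of n] k unfolding h_def by linarith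
  qed
qed

lemma power_over_two_power: "(\<lambda>n. real n ^ k / 2 ^ n) \<longlonglongrightarrow> 0"
proof -
  have l2: "ln (2::real) > 0" by simp
  have "filterlim (\<lambda>n. ln 2 * real n) at_top sequentially"
    by (rule filterlim_tendsto_pos_mult_at_top[OF tendsto_const l2 filterlim_real_sequentially])
  from filterlim_compose[OF tendsto_power_div_exp_0 this, of k]
  have "(\<lambda>n. (ln 2 * real n) ^ k / exp (ln 2 * real n)) \<longlonglongrightarrow> 0" .
  then have "(\<lambda>n. (1 / ln 2) ^ k * ((ln 2 * real n) ^ k / exp (ln 2 * real n))) \<longlonglongrightarrow> (1 / ln 2) ^ k * 0"
    by (rule tendsto_mult[OF tendsto_const])
  moreover have "(1 / ln 2) ^ k * ((ln 2 * real n) ^ k / exp (ln 2 * real n)) = real n ^ k / 2 ^ n" for n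
  proof -
    have "exp (ln 2 * real n) = (2::real) ^ n" by (simp add: exp_of_nat2_mult)
    then show ?thesis using l2 by (simp add: power_mult_distrib power_one_over)
  qed
  ultimately show ?thesis by simp
qed

lemma binomial_le_over_two_power: "(\<lambda>n. real (binomial_le n r) / 2 ^ n) \<longlonglongrightarrow> 0"
proof (rule Lim_transform_eventually)
  show "(\<lambda>n. (real (binomial_le n r) / real n ^ r) * (real n ^ r / 2 ^ n)) \<longlonglongrightarrow> 0"
    using tendsto_mult[OF binomial_le_over_power[of r] power_over_two_power[of r]] by simp
  show "\<forall>\<^sub>F n in sequentially. (real (binomial_le n r) / real n ^ r) * (real n ^ r / 2 ^ n)
      = real (binomial_le n r) / 2 ^ n"
    using eventually_gt_at_top[of 0] by eventually_elim simp
qed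

lemma binomial_le_ratio:
  assumes f: "filterlim f at_top sequentially" and g: "filterlim g at_top sequentially"
    and q: "(\<lambda>N. real (f N) / real (g N)) \<longlonglongrightarrow> q"
  shows "(\<lambda>N. real (binomial_le (f N) r) / real (binomial_le (g N) r)) \<longlonglongrightarrow> q ^ r"
proof (rule Lim_transform_eventually)
  let ?\<beta> = "\<lambda>n. real (binomial_le n r) / real n ^ r"
  have "(\<lambda>N. ?\<beta> (f N) / ?\<beta> (g N) * (real (f N) / real (g N)) ^ r)
      \<longlonglongrightarrow> (1 / fact r) / (1 / fact r) * q ^ r"
    by (intro tendsto_mult tendsto_divide tendsto_power q
        filterlim_compose[OF binomial_le_over_power f] filterlim_compose[OF binomial_le_over_power g]) simp
  then show "(\<lambda>N. ?\<beta> (f N) / ?\<beta> (g N) * (real (f N) / real (g N)) ^ r) \<longlonglongrightarrow> q ^ r" by simp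
  have "\<forall>\<^sub>F N in sequentially. f N > 0" "\<forall>\<^sub>F N in sequentially. g N > 0"
    using f g eventually_gt_at_top[of 0] by (auto simp: filterlim_iff)
  then show "\<forall>\<^sub>F N in sequentially. ?\<beta> (f N) / ?\<beta> (g N) * (real (f N) / real (g N)) ^ r
      = real (binomial_le (f N) r) / real (binomial_le (g N) r)"
  proof eventually_elim
    case (elim N)
    have "a / x / (b / y) * (x / y) = a / b" if "x > 0" "y > 0" for a b x y :: real
      using that by simp
    from this[of "real (f N) ^ r" "real (g N) ^ r"] show ?case
      using elim by (simp only: power_divide) simp
  qed
qed

lemma binomial_le_Suc_ratio:
  assumes f: "filterlim f at_top sequentially" and g: "filterlim g at_top sequentially"
    and q: "(\<lambda>N. real (f N) / real (g N)) \<longlonglongrightarrow> q"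
  shows "(\<lambda>N. real (binomial_le (f N) (Suc r)) / (real (binomial_le (g N) r) * real (f N)))
    \<longlonglongrightarrow> q ^ r / Suc r"
proof (rule Lim_transform_eventually)
  let ?\<beta> = "\<lambda>k n. real (binomial_le n k) / real n ^ k"
  have "(\<lambda>N. ?\<beta> (Suc r) (f N) / ?\<beta> r (g N) * (real (f N) / real (g N)) ^ r)
      \<longlonglongrightarrow> (1 / fact (Suc r)) / (1 / fact r) * q ^ r"
    by (intro tendsto_mult tendsto_divide tendsto_power q
        filterlim_compose[OF binomial_le_over_power f] filterlim_compose[OF binomial_le_over_power g]) simp
  then show "(\<lambda>N. ?\<beta> (Suc r) (f N) / ?\<beta> r (g N) * (real (f N) / real (g N)) ^ r) \<longlonglongrightarrow> q ^ r / Suc r"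
    by simp
  have "\<forall>\<^sub>F N in sequentially. f N > 0" "\<forall>\<^sub>F N in sequentially. g N > 0"
    using f g eventually_gt_at_top[of 0] by (auto simp: filterlim_iff)
  then show "\<forall>\<^sub>F N in sequentially. ?\<beta> (Suc r) (f N) / ?\<beta> r (g N) * (real (f N) / real (g N)) ^ r
      = real (binomial_le (f N) (Suc r)) / (real (binomial_le (g N) r) * real (f N))"
  proof eventually_elim
    case (elim N)
    have "a / (z * x) / (b / y) * (x / y) = a / (b * z)" if "x > 0" "y > 0" "z > 0" for a b x y z :: real
      using that by simp
    from this[of "real (f N) ^ r" "real (g N) ^ r" "real (f N)"] show ?case
      using elim by (simp only: power_divide power_Suc) simp
  qed
qed

text \<open>With \<open>n = N div R\<close> and \<open>m = N - n\<close>, the quotient of ball volumes in the first term of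
  \<open>cov_density_recursion\<close> tends to \<open>(R / (R - 1))^(R - 1)\<close> and the one in the second term to \<open>R^R\<close>. Among
  all splittings in a fixed proportion this one minimises the first limit.\<close>

lemma cov_density_eventually_le:
  fixes \<delta> A \<kappa> :: real
  assumes R: "R \<ge> 2" and \<delta>: "\<delta> > 0"
    and A: "\<delta> * (real R / real (R - 1)) ^ (R - 1) < A" and \<kappa>: "exp (- \<delta>) * real R ^ R < \<kappa>"
  shows "\<forall>\<^sub>F N in sequentially. cov_density N R \<le> A + \<kappa> * cov_density (N div R) R"
proof -
  define r where "r = R - 1"
  have Rr: "R = Suc r" "r > 0" using R by (auto simp: r_def)
  define n m where "n N = N div R" and "m N = N - N div R" for N :: nat
  have nm: "m N + n N = N" for N by (simp add: n_def m_def)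
  have R0: "R > 0" using R by simp
  have n_top: "filterlim n at_top sequentially" unfolding n_def using R by (intro filterlim_div) simp
  have n_lim: "(\<lambda>N. real (n N) / real N) \<longlonglongrightarrow> 1 / real R"
    unfolding n_def using R by (intro div_over_self) simp
  have m_lim: "(\<lambda>N. real (m N) / real N) \<longlonglongrightarrow> real r / real R"
  proof (rule Lim_transform_eventually)
    show "(\<lambda>N. 1 - real (n N) / real N) \<longlonglongrightarrow> real r / real R"
      using tendsto_diff[OF tendsto_const n_lim, of 1] Rr by (simp add: field_simps)
    show "\<forall>\<^sub>F N in sequentially. 1 - real (n N) / real N = real (m N) / real N"
      using eventually_gt_at_top[of 0]
    proof eventually_elim
      case (elim N)
      have "real (m N) = real N - real (n N)" using nm[of N] by linarith
      then show ?case using elim by (simp add: diff_divide_distrib)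
    qed
  qed
  have m_top: "filterlim m at_top sequentially"
  proof (rule filterlim_at_top_mono[OF n_top])
    show "\<forall>\<^sub>F N in sequentially. n N \<le> m N"
    proof (intro always_eventually allI)
      fix N :: nat
      have "N div R * 2 \<le> N div R * R" using R by (intro mult_le_mono2)
      also have "\<dots> \<le> N" by simp
      finally show "n N \<le> m N" unfolding n_def m_def by linarith
    qed
  qed
  have id_top: "filterlim (\<lambda>N::nat. N) at_top sequentially" by (rule filterlim_ident)
  have Nn_lim: "(\<lambda>N. real N / real (n N)) \<longlonglongrightarrow> real R"
    using tendsto_inverse[OF n_lim] R0 by (simp add: inverse_eq_divide)
  have Nm_lim: "(\<lambda>N. real N / real (m N)) \<longlonglongrightarrow> real R / real r"
    using tendsto_inverse[OF m_lim] R0 Rr by (simp add: inverse_eq_divide)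
  define Q where "Q N = real (binomial_le N R) / (real (binomial_le (m N) r) * real (n N))" for N
  define S where "S N = real (binomial_le N R) / real (binomial_le (n N) R)" for N
  define E where "E N = real (binomial_le (m N) r) / 2 ^ (m N)" for N
  have S_lim: "S \<longlonglongrightarrow> real R ^ R"
    unfolding S_def by (rule binomial_le_ratio[OF id_top n_top Nn_lim])
  have E_lim: "E \<longlonglongrightarrow> 0"
    unfolding E_def by (rule filterlim_compose[OF binomial_le_over_two_power m_top])
  have Q_lim: "Q \<longlonglongrightarrow> (real R / real r) ^ r"
  proof (rule Lim_transform_eventually)
    show "(\<lambda>N. real (binomial_le N (Suc r)) / (real (binomial_le (m N) r) * real N) * (real N / real (n N)))
        \<longlonglongrightarrow> (real R / real r) ^ r"
      using tendsto_mult[OF binomial_le_Suc_ratio[OF id_top m_top Nm_lim, of r] Nn_lim] R0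
      unfolding Rr(1)[symmetric] by simp
    show "\<forall>\<^sub>F N in sequentially.
        real (binomial_le N (Suc r)) / (real (binomial_le (m N) r) * real N) * (real N / real (n N)) = Q N"
      using eventually_gt_at_top[of 0]
    proof eventually_elim
      case (elim N)
      have "a / (b * x) * (x / y) = a / (b * y)" if "x > 0" for a b x y :: real using that by simp
      from this[of "real N"] show ?case using elim unfolding Q_def Rr(1) by simp
    qed
  qed
  define a where "a = (real R / real r) ^ r"
  have a0: "a > 0" using Rr by (simp add: a_def)
  have Aa: "\<delta> * a < A" using A by (simp add: a_def r_def)
  have \<delta>a: "\<delta> * a > 0" using \<delta> a0 by simp
  \<comment> \<open>the gap between \<open>\<delta> a\<close> and \<open>A\<close> determines how close to 1 the density of the codes of radius 1 has to be\<close>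
  define q where "q = A / (\<delta> * a)"
  have q: "q > 1" using Aa \<delta>a by (simp add: q_def)
  define \<eta> where "\<eta> = (q - 1) / 2"
  have \<eta>0: "\<eta> > 0" using q by (simp add: \<eta>_def)
  have \<eta>: "(1 + \<eta>) * (\<delta> * a) < A"
  proof -
    have "1 + \<eta> < q" using q by (simp add: \<eta>_def field_simps)
    then show ?thesis using \<delta>a by (simp add: q_def pos_less_divide_eq)
  qed
  have "(\<lambda>N. (1 + \<eta>) * ((\<delta> + E N) * Q N)) \<longlonglongrightarrow> (1 + \<eta>) * ((\<delta> + 0) * a)"
    unfolding a_def by (intro tendsto_mult tendsto_add tendsto_const E_lim Q_lim)
  then have ev1: "\<forall>\<^sub>F N in sequentially. (1 + \<eta>) * ((\<delta> + E N) * Q N) < A"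
    using \<eta> by (intro order_tendstoD) auto
  have "(\<lambda>N. exp (- \<delta>) * S N) \<longlonglongrightarrow> exp (- \<delta>) * real R ^ R"
    by (intro tendsto_mult tendsto_const S_lim)
  then have ev2: "\<forall>\<^sub>F N in sequentially. exp (- \<delta>) * S N < \<kappa>"
    using \<kappa> by (intro order_tendstoD) auto
  have ev3: "\<forall>\<^sub>F N in sequentially. real (cov_num (n N) 1) * real (n N) \<le> (1 + \<eta>) * 2 ^ (n N)"
    by (rule eventually_compose_filterlim[OF radius_one_density[OF \<eta>0] n_top])
  have ev4: "\<forall>\<^sub>F N in sequentially. n N > 0"
    using n_top eventually_gt_at_top[of 0] by (auto simp: filterlim_iff)
  show ?thesis
    using ev1 ev2 ev3 ev4
  proof eventually_elim
    case (elim N)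
    have nonneg: "(\<delta> + E N) * Q N \<ge> 0" "cov_density (n N) R \<ge> 0"
      using \<delta> by (simp_all add: E_def Q_def cov_density_def)
    have one: "real (cov_num (n N) 1) * real (n N) / 2 ^ (n N) \<le> 1 + \<eta>"
      using elim(3) by (simp add: pos_divide_le_eq)
    have "cov_density (m N + n N) (r + 1)
      \<le> (real (cov_num (n N) 1) * n N / 2 ^ n N) * (\<delta> + E N)
          * (real (binomial_le (m N + n N) (r + 1)) / (real (binomial_le (m N) r) * n N))
        + exp (- \<delta>) * (real (binomial_le (m N + n N) (r + 1)) / real (binomial_le (n N) (r + 1)))
          * cov_density (n N) (r + 1)"
      unfolding E_def by (rule cov_density_recursion[OF \<delta> elim(4)])
    then have "cov_density N R
      \<le> (real (cov_num (n N) 1) * n N / 2 ^ n N) * ((\<delta> + E N) * Q N)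
        + exp (- \<delta>) * S N * cov_density (n N) R"
      unfolding nm Q_def S_def Rr(1) by (simp add: mult.assoc)
    also have "\<dots> \<le> (1 + \<eta>) * ((\<delta> + E N) * Q N) + \<kappa> * cov_density (n N) R"
      using elim(2) by (intro add_mono mult_right_mono one nonneg) simp
    also have "\<dots> \<le> A + \<kappa> * cov_density (n N) R" using elim(1) by simp
    finally show ?case by (simp add: n_def)
  qed
qed

text \<open>Put \<open>L = R log R\<close> and \<open>\<delta> = L + log L + 1\<close>, which makes the factor \<open>\<kappa>\<close> of the recursive term equal to
  \<open>1 / (e L)\<close>. The strict inequality \<open>\<delta> / (1 - \<kappa>) < \<delta> + 3\<close> means \<open>(\<delta> + 3) / (e L) < 3\<close>, which follows from
  \<open>log L \<le> L - 1\<close> and \<open>L > 1\<close>. Its slack absorbs the error terms, and the bound \<open>c\<close> remains strictly below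
  the target.\<close>

theorem cov_density_bound:
  fixes R :: nat
  assumes R: "R \<ge> 2"
  obtains c where "c < exp 1 * (real R * ln (real R) + ln (real R) + ln (ln (real R)) + 4)"
    "\<forall>\<^sub>F n in sequentially. cov_density n R \<le> c"
proof -
  define L where "L = real R * ln (real R)"
  have lnR: "ln (real R) > 1 / 2"
  proof -
    have "exp (1 / 2 :: real) ^ 2 = exp 1" by (simp flip: exp_of_nat_mult)
    also have "\<dots> < 2 ^ 2" using exp_le by simp
    finally have "exp (1 / 2 :: real) < 2" by (rule power_less_imp_less_base) simp
    also have "2 \<le> real R" using R by simp
    finally show ?thesis using R by (subst exp_less_cancel_iff[symmetric]) simp
  qed
  have "2 * (1 / 2) < real R * ln (real R)" using R lnR by (intro mult_le_less_imp_less) auto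
  then have L1: "L > 1" by (simp add: L_def)
  define \<delta> where "\<delta> = L + ln L + 1"
  have \<delta>0: "\<delta> > 0" using L1 by (simp add: \<delta>_def add_pos_pos)
  have target: "exp 1 * (real R * ln (real R) + ln (real R) + ln (ln (real R)) + 4) = exp 1 * (\<delta> + 3)"
    using R lnR by (simp add: \<delta>_def L_def ln_mult)
  define \<kappa> where "\<kappa> = 1 / (exp 1 * L)"
  have \<kappa>: "exp (- \<delta>) * real R ^ R = \<kappa>"
  proof -
    have "real R ^ R = exp L" using R unfolding L_def by (simp add: exp_of_nat_mult)
    moreover have "exp (- \<delta>) = exp (- L) * exp (- ln L) * exp (- 1)"
      by (simp add: \<delta>_def flip: exp_add)
    ultimately show ?thesis using L1 by (simp add: \<kappa>_def exp_minus field_simps)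
  qed
  have e2: "exp (1::real) \<ge> 2" using exp_ge_add_one_self[of 1] by simp
  have eL: "exp 1 * L > 2" 
  proof -
    have "exp 1 * 1 < exp 1 * L" using L1 by (intro mult_strict_left_mono) auto
    then show ?thesis using e2 by linarith
  qed
  have \<kappa>01: "0 < \<kappa>" "\<kappa> < 1" using eL L1 by (auto simp: \<kappa>_def)
  have key: "exp 1 * \<delta> / (1 - \<kappa>) < exp 1 * (\<delta> + 3)"
  proof -
    have "ln L \<le> L - 1" using L1 by (intro ln_le_minus_one) simp
    then have "\<delta> + 3 \<le> 2 * L + 3" by (simp add: \<delta>_def)
    also have "\<dots> < 3 * (2 * L)" using L1 by simp
    also have "\<dots> \<le> 3 * (exp 1 * L)" using e2 L1 by (intro mult_left_mono mult_right_mono) auto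
    finally have "(\<delta> + 3) * \<kappa> < 3" using eL by (simp add: \<kappa>_def pos_divide_less_eq)
    then have "\<delta> < (\<delta> + 3) * (1 - \<kappa>)" by (simp add: algebra_simps)
    then have "\<delta> / (1 - \<kappa>) < \<delta> + 3" using \<kappa>01 by (simp add: pos_divide_less_eq)
    then show ?thesis using mult_strict_left_mono[of "\<delta> / (1 - \<kappa>)" "\<delta> + 3" "exp 1"] by simp
  qed
  have "((\<lambda>t. (exp 1 * \<delta> + t) / (1 - (\<kappa> + t)) + t) \<longlongrightarrow> (exp 1 * \<delta> + 0) / (1 - (\<kappa> + 0)) + 0) (at_right 0)"
    using \<kappa>01 by (intro tendsto_add tendsto_divide tendsto_diff tendsto_const tendsto_ident_at) auto
  then have "\<forall>\<^sub>F t in at_right 0. (exp 1 * \<delta> + t) / (1 - (\<kappa> + t)) + t < exp 1 * (\<delta> + 3)"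
    using key by (intro order_tendstoD) auto
  moreover have "\<forall>\<^sub>F t in at_right 0. t < 1 - \<kappa>"
    using \<kappa>01 eventually_at_right_less by (intro eventually_at_rightI[of 0 "1 - \<kappa>"]) auto
  moreover have "\<forall>\<^sub>F t in at_right (0::real). t > 0" by (rule eventually_at_right_less)
  ultimately have "\<forall>\<^sub>F t in at_right 0. (exp 1 * \<delta> + t) / (1 - (\<kappa> + t)) + t < exp 1 * (\<delta> + 3)
      \<and> t < 1 - \<kappa> \<and> t > 0" by eventually_elim simp
  then obtain t where t: "(exp 1 * \<delta> + t) / (1 - (\<kappa> + t)) + t < exp 1 * (\<delta> + 3)" "t < 1 - \<kappa>" "t > 0"
    using eventually_happens' trivial_limit_at_right_real by blast
  have "(real R / real (R - 1)) ^ (R - 1) \<le> exp 1"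
  proof -
    have "real R / real (R - 1) = 1 + 1 / real (R - 1)" using R by (simp add: field_simps)
    also have "\<dots> \<le> exp (1 / real (R - 1))" by (rule exp_ge_add_one_self)
    finally have "(real R / real (R - 1)) ^ (R - 1) \<le> exp (1 / real (R - 1)) ^ (R - 1)"
      by (intro power_mono) auto
    also have "\<dots> = exp 1" using R by (simp flip: exp_of_nat_mult)
    finally show ?thesis .
  qed
  then have "\<delta> * (real R / real (R - 1)) ^ (R - 1) \<le> \<delta> * exp 1"
    using \<delta>0 by (intro mult_left_mono) auto
  then have A: "\<delta> * (real R / real (R - 1)) ^ (R - 1) < exp 1 * \<delta> + t" using t by (simp add: mult.commute)
  have "\<forall>\<^sub>F N in sequentially. cov_density N R \<le> (exp 1 * \<delta> + t) + (\<kappa> + t) * cov_density (N div R) R"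
    by (rule cov_density_eventually_le[OF R \<delta>0 A]) (use \<kappa> t in simp)
  then have "\<forall>\<^sub>F N in sequentially. cov_density N R \<le> (exp 1 * \<delta> + t) / (1 - (\<kappa> + t)) + t"
    using \<kappa>01 t by (intro eventually_le_contraction_limit[OF R]) auto
  then show ?thesis using t(1) target that by metis
qed

section \<open>Normal codes\<close>

definition word :: "nat \<Rightarrow> nat set \<Rightarrow> nat \<Rightarrow> bit" where
  "word n x = (\<lambda>i\<in>{1..n}. of_bool (i \<in> x))"

lemma word_in_cube: "word n x \<in> cube n"
  by (auto simp: word_def cube_def)

lemma cube_eq_words: "cube n = word n ` Pow {1..n}"
proof (intro equalityI subsetI)
  fix w assume w: "w \<in> cube n"
  have "w = word n {i \<in> {1..n}. w i = 1}"
  proof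
    fix i show "w i = word n {i \<in> {1..n}. w i = 1} i"
      using w by (cases "i \<in> {1..n}") (auto simp: word_def cube_def PiE_def extensional_def)
  qed
  then show "w \<in> word n ` Pow {1..n}" by blast
qed (auto simp: word_in_cube)

lemma hamming_word:
  "x \<subseteq> {1..n} \<Longrightarrow> y \<subseteq> {1..n} \<Longrightarrow> hamming n (word n x) (word n y) = card (sym_diff x y)"
  unfolding hamming_def by (rule arg_cong[of _ _ card]) (auto simp: word_def)

text \<open>The infimum is attained; the empty set has distance \<open>\<infinity>\<close>, in agreement with the right-hand side.\<close>

lemma set_hamming_le_iff: "set_hamming n x Y \<le> enat d \<longleftrightarrow> (\<exists>y\<in>Y. hamming n x y \<le> d)"
proof
  assume le: "set_hamming n x Y \<le> enat d"
  show "\<exists>y\<in>Y. hamming n x y \<le> d"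
  proof (rule ccontr)
    assume "\<not> ?thesis"
    then have "enat (Suc d) \<le> set_hamming n x Y"
      unfolding set_hamming_def by (intro INF_greatest) (simp add: not_le Suc_le_eq)
    with le have "enat (Suc d) \<le> enat d" by (rule order_trans[rotated])
    then show False by simp
  qed
next
  assume "\<exists>y\<in>Y. hamming n x y \<le> d"
  then show "set_hamming n x Y \<le> enat d"
    unfolding set_hamming_def by (auto intro: INF_lower2)
qed

lemma covering_radius_le_iff:
  assumes "C \<subseteq> Pow {1..n}"
  shows "covering_radius n (word n ` C) \<le> enat r \<longleftrightarrow> covers {1..n} r C"
proof -
  let ?P = "\<lambda>r. \<forall>x\<in>cube n. set_hamming n x (word n ` C) \<le> r"
  have "?P (enat r) \<longleftrightarrow> (\<forall>x\<in>Pow {1..n}. \<exists>c\<in>C. hamming n (word n x) (word n c) \<le> r)" for r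
    by (simp add: cube_eq_words set_hamming_le_iff)
  also have "\<dots> r \<longleftrightarrow> (\<forall>x\<in>Pow {1..n}. \<exists>c\<in>C. card (sym_diff x c) \<le> r)" for r
  proof (intro ball_cong bex_cong refl)
    fix x c assume "x \<in> Pow {1..n}" "c \<in> C"
    then have "hamming n (word n x) (word n c) = card (sym_diff x c)"
      using assms by (intro hamming_word) auto
    then show "(hamming n (word n x) (word n c) \<le> r) = (card (sym_diff x c) \<le> r)" by simp
  qed
  finally have P: "?P (enat r) \<longleftrightarrow> covers {1..n} r C" for r
    using assms by (simp add: covers_def near_def Ball_def)
  have "?P (covering_radius n (word n ` C))"
    unfolding covering_radius_def by (rule LeastI[of ?P \<infinity>]) simp
  then have "covering_radius n (word n ` C) \<le> enat r \<Longrightarrow> ?P (enat r)"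
    by (meson order_trans)
  moreover have "?P (enat r) \<Longrightarrow> covering_radius n (word n ` C) \<le> enat r"
    unfolding covering_radius_def by (rule Least_le)
  ultimately show ?thesis using P by blast
qed

text \<open>The code \<open>D\<close> consists of all codewords of an optimal \<open>C\<close>, each with both values of the new last
  coordinate. If \<open>c\<close> is within \<open>d \<le> r\<close> of a word in the other coordinates, one copy of \<open>c\<close> is at distance
  \<open>d\<close> from the word and the other at distance \<open>d + 1\<close>. The size hypothesis contradicts the sphere-covering bound for radius \<open>r - 1\<close>, so
  the covering radius of \<open>D\<close> is not smaller than \<open>r\<close>.\<close>

lemma K_normal_le:
  assumes r: "r > 0" and small: "2 * cov_num m r * binomial_le (Suc m) (r - 1) < 2 ^ Suc m"
  shows "K_normal (Suc m) r \<le> enat (2 * cov_num m r)"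
proof -
  let ?n = "Suc m"
  obtain C where C: "covers {1..m} r C" "card C = cov_num m r"
    using cov_num_attained[of "{1..m}" m r] by auto
  have CI: "C \<subseteq> Pow {1..m}" and finC: "finite C"
    using C covers_finite[OF _ C(1)] by (auto simp: covers_def)
  define D where "D = C \<union> insert ?n ` C"
  have DI: "D \<subseteq> Pow {1..?n}"
  proof
    fix d assume "d \<in> D"
    then obtain c where "c \<in> C" "d = c \<or> d = insert ?n c" unfolding D_def by blast
    moreover from this have "c \<subseteq> {1..m}" using CI by blast
    then have "c \<subseteq> {1..?n}" by auto
    ultimately show "d \<in> Pow {1..?n}" by auto
  qed
  have finD: "finite D" using finC by (simp add: D_def)
  have cD: "card D \<le> 2 * cov_num m r"
    using card_Un_le[of C "insert ?n ` C"] card_image_le[OF finC, of "insert ?n"] C(2)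
    unfolding D_def by linarith
  have split: "\<exists>c\<in>C. card (sym_diff x c) + card (sym_diff x (insert ?n c)) \<le> 2 * r + 1
       \<and> (card (sym_diff x c) \<le> r \<or> card (sym_diff x (insert ?n c)) \<le> r)"
    if x: "x \<subseteq> {1..?n}" for x
  proof -
    have "x - {?n} \<subseteq> {1..m}" using x by auto
    then obtain c where c: "c \<in> C" "card (sym_diff (x - {?n}) c) \<le> r"
      using C(1) unfolding covers_def near_def by blast
    have "c \<subseteq> {1..m}" using c(1) CI by blast
    then have nc: "?n \<notin> c" by auto
    define s where "s = sym_diff (x - {?n}) c"
    have s: "card s \<le> r" "?n \<notin> s" using c(2) nc by (auto simp: s_def)
    have "finite x" using x finite_subset by blast
    moreover have "finite c" using c CI by (meson PowD finite_atLeastAtMost finite_subset subsetD)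
    ultimately have fs: "finite s" by (simp add: s_def)
    have "sym_diff x c = (if ?n \<in> x then insert ?n s else s)"
      "sym_diff x (insert ?n c) = (if ?n \<in> x then s else insert ?n s)"
      unfolding s_def using nc by (cases "?n \<in> x"; simp; blast)+
    then show ?thesis using c(1) s fs by (intro bexI[of _ c]) auto
  qed
  have covD: "covers {1..?n} r D"
    unfolding covers_def near_def
  proof (intro conjI DI allI impI)
    fix x assume "x \<subseteq> {1..?n}"
    from split[OF this] obtain c where "c \<in> C"
      "card (sym_diff x c) \<le> r \<or> card (sym_diff x (insert ?n c)) \<le> r" by blast
    then show "\<exists>d\<in>D. card (sym_diff x d) \<le> r" unfolding D_def by blast
  qed
  have "covering_radius ?n (word ?n ` D) = enat r"
  proof (rule antisym)
    show "covering_radius ?n (word ?n ` D) \<le> enat r" using covering_radius_le_iff[OF DI] covD by simp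
    have "\<not> covers {1..?n} (r - 1) D"
    proof
      assume "covers {1..?n} (r - 1) D"
      then have "2 ^ ?n \<le> card D * binomial_le ?n (r - 1)" by (intro covers_card_ge) auto
      also have "\<dots> \<le> 2 * cov_num m r * binomial_le ?n (r - 1)" using cD by (rule mult_le_mono1)
      finally show False using small by simp
    qed
    then have "enat (r - 1) < covering_radius ?n (word ?n ` D)"
      using covering_radius_le_iff[OF DI] by (simp add: not_le[symmetric])
    then show "enat r \<le> covering_radius ?n (word ?n ` D)"
      using r by (cases "covering_radius ?n (word ?n ` D)") auto
  qed
  moreover have "word ?n ` D \<subseteq> cube ?n" by (auto simp: word_in_cube)
  moreover have "min_norm ?n (word ?n ` D) \<le> enat (2 * r + 1)"
  proof -
    have "min_norm ?n (word ?n ` D) \<le> code_norm ?n (word ?n ` D) ?n"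
      unfolding min_norm_def by (rule INF_lower) simp
    also have "\<dots> \<le> enat (2 * r + 1)"
      unfolding code_norm_def
    proof (rule Max.boundedI)
      show "finite ((\<lambda>x. set_hamming ?n x (subcode (word ?n ` D) ?n 0)
          + set_hamming ?n x (subcode (word ?n ` D) ?n 1)) ` cube ?n)"
        by (simp add: cube_eq_words)
      show "(\<lambda>x. set_hamming ?n x (subcode (word ?n ` D) ?n 0)
          + set_hamming ?n x (subcode (word ?n ` D) ?n 1)) ` cube ?n \<noteq> {}"
        using word_in_cube[of ?n "{}"] by blast
      fix a assume "a \<in> (\<lambda>x. set_hamming ?n x (subcode (word ?n ` D) ?n 0)
          + set_hamming ?n x (subcode (word ?n ` D) ?n 1)) ` cube ?n"
      then obtain x where x: "x \<subseteq> {1..?n}" and a: "a = set_hamming ?n (word ?n x) (subcode (word ?n ` D) ?n 0)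
          + set_hamming ?n (word ?n x) (subcode (word ?n ` D) ?n 1)"
        by (auto simp: cube_eq_words)
      obtain c where c: "c \<in> C" "card (sym_diff x c) + card (sym_diff x (insert ?n c)) \<le> 2 * r + 1"
        using split[OF x] by blast
      have "c \<subseteq> {1..m}" using c(1) CI by blast
      then have cn: "c \<subseteq> {1..?n}" "insert ?n c \<subseteq> {1..?n}" "?n \<notin> c" by auto
      have "c \<in> D" "insert ?n c \<in> D" using c(1) by (auto simp: D_def)
      moreover have "word ?n c ?n = 0" "word ?n (insert ?n c) ?n = 1"
        using cn(3) by (simp_all add: word_def)
      ultimately have 0: "word ?n c \<in> subcode (word ?n ` D) ?n 0"
        and 1: "word ?n (insert ?n c) \<in> subcode (word ?n ` D) ?n 1"
        by (simp_all add: subcode_def)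
      have "set_hamming ?n (word ?n x) (subcode (word ?n ` D) ?n 0) \<le> enat (card (sym_diff x c))"
        unfolding set_hamming_le_iff using 0 hamming_word[OF x cn(1)] by (intro bexI) auto
      moreover have "set_hamming ?n (word ?n x) (subcode (word ?n ` D) ?n 1)
          \<le> enat (card (sym_diff x (insert ?n c)))"
        unfolding set_hamming_le_iff using 1 hamming_word[OF x cn(2)] by (intro bexI) auto
      ultimately have "a \<le> enat (card (sym_diff x c)) + enat (card (sym_diff x (insert ?n c)))"
        unfolding a by (rule add_mono)
      also have "\<dots> \<le> enat (2 * r + 1)" using c(2) by simp
      finally show "a \<le> enat (2 * r + 1)" .
    qed
    finally show ?thesis .
  qed
  ultimately have "is_normal_code ?n r (word ?n ` D)" by (simp add: is_normal_code_def is_code_def)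
  then have "K_normal ?n r \<le> enat (card (word ?n ` D))"
    unfolding K_normal_def by (intro INF_lower) simp
  also have "\<dots> \<le> enat (2 * cov_num m r)" using cD card_image_le[OF finD, of "word ?n"] by simp
  finally show ?thesis .
qed

lemma normal_density_le:
  assumes r: "r > 0"
    and small: "cov_density m r * (real (binomial_le (Suc m) (r - 1)) / real (binomial_le m r)) < 1"
  shows "normal_density (Suc m) r
    \<le> ereal (cov_density m r * (real (binomial_le (Suc m) r) / real (binomial_le m r)))"
proof -
  define K where "K = real (cov_num m r)"
  have b0: "real (binomial_le k s) > 0" for k s using binomial_le_pos by simp
  have e: "cov_density m r * (B / real (binomial_le m r)) = 2 * K * B / 2 ^ Suc m" for B :: real
    using b0[of m r] by (simp add: cov_density_def K_def)
  have "2 * K * real (binomial_le (Suc m) (r - 1)) < 2 ^ Suc m"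
    using small unfolding e by (simp only: pos_divide_less_eq zero_less_power zero_less_numeral mult_1)
  then have "real (2 * cov_num m r * binomial_le (Suc m) (r - 1)) < real (2 ^ Suc m)"
    by (simp add: K_def)
  then have "2 * cov_num m r * binomial_le (Suc m) (r - 1) < 2 ^ Suc m" by (simp only: of_nat_less_iff)
  from K_normal_le[OF r this] have "ereal_of_enat (K_normal (Suc m) r) \<le> ereal_of_enat (enat (2 * cov_num m r))"
    by (simp only: ereal_of_enat_le_iff)
  then have "ereal_of_enat (K_normal (Suc m) r) \<le> ereal (2 * K)" by (simp add: K_def)
  then have "normal_density (Suc m) r \<le> ereal (2 * K) / ereal (2 ^ Suc m / real (binomial_le (Suc m) r))"
    unfolding normal_density_def using b0 by (intro ereal_divide_right_mono) auto
  also have "\<dots> = ereal (2 * K * real (binomial_le (Suc m) r) / 2 ^ Suc m)"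
    using b0[of "Suc m" r] by simp
  finally show ?thesis unfolding e .
qed

theorem theorem4:
  fixes R :: nat
  assumes "R \<ge> 2"
  shows "normal_density_limsup R
    \<le> ereal (exp 1 * (real R * ln (real R) + ln (real R) + ln (ln (real R)) + 4))"
proof -
  let ?T = "exp 1 * (real R * ln (real R) + ln (real R) + ln (ln (real R)) + 4)"
  obtain c where c: "c < ?T" "\<forall>\<^sub>F n in sequentially. cov_density n R \<le> c"
    using cov_density_bound[OF assms] .
  define r where "r = R - 1"
  have Rr: "R = Suc r" using assms by (simp add: r_def)
  have id: "filterlim (\<lambda>n::nat. n) at_top sequentially" by (rule filterlim_ident)
  have q: "(\<lambda>n. real (Suc n) / real n) \<longlonglongrightarrow> 1" by (rule LIMSEQ_Suc_n_over_n)
  have q': "(\<lambda>n. real n / real (Suc n)) \<longlonglongrightarrow> 1" by (rule LIMSEQ_n_over_Suc_n)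
  have B1: "(\<lambda>n. real (binomial_le (Suc n) R) / real (binomial_le n R)) \<longlonglongrightarrow> 1"
    using binomial_le_ratio[OF filterlim_Suc id q, of R] by simp
  have B2: "(\<lambda>n. real (binomial_le (Suc n) r) / real (binomial_le n R)) \<longlonglongrightarrow> 0"
  proof (rule Lim_transform_eventually)
    have "(\<lambda>n. inverse (real (binomial_le n R) / (real (binomial_le (Suc n) r) * real n)) * inverse (real n))
        \<longlonglongrightarrow> inverse (1 ^ r / real (Suc r)) * 0"
      unfolding Rr by (intro tendsto_mult tendsto_inverse binomial_le_Suc_ratio[OF id filterlim_Suc q']
          lim_inverse_n) simp
    then show "(\<lambda>n. inverse (real (binomial_le n R) / (real (binomial_le (Suc n) r) * real n)) * inverse (real n))
        \<longlonglongrightarrow> 0" by simp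
    show "\<forall>\<^sub>F n in sequentially.
        inverse (real (binomial_le n R) / (real (binomial_le (Suc n) r) * real n)) * inverse (real n)
        = real (binomial_le (Suc n) r) / real (binomial_le n R)"
      using eventually_gt_at_top[of 0] by eventually_elim (simp add: field_simps)
  qed
  have "(\<lambda>n. c * (real (binomial_le (Suc n) R) / real (binomial_le n R))) \<longlonglongrightarrow> c * 1"
    by (intro tendsto_mult tendsto_const B1)
  then have ev1: "\<forall>\<^sub>F n in sequentially. c * (real (binomial_le (Suc n) R) / real (binomial_le n R)) < ?T"
    using c(1) by (intro order_tendstoD) auto
  have "(\<lambda>n. c * (real (binomial_le (Suc n) r) / real (binomial_le n R))) \<longlonglongrightarrow> c * 0"
    by (intro tendsto_mult tendsto_const B2)
  then have ev2: "\<forall>\<^sub>F n in sequentially. c * (real (binomial_le (Suc n) r) / real (binomial_le n R)) < 1"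
    by (intro order_tendstoD) auto
  have "\<forall>\<^sub>F n in sequentially. normal_density (Suc n) R \<le> ereal ?T"
    using ev1 ev2 c(2)
  proof eventually_elim
    case (elim n)
    have "cov_density n R * (real (binomial_le (Suc n) r) / real (binomial_le n R))
        \<le> c * (real (binomial_le (Suc n) r) / real (binomial_le n R))"
      using elim(3) by (rule mult_right_mono) simp
    then have "cov_density n R * (real (binomial_le (Suc n) (R - 1)) / real (binomial_le n R)) < 1"
      using elim(2) unfolding r_def by linarith
    then have "normal_density (Suc n) R
        \<le> ereal (cov_density n R * (real (binomial_le (Suc n) R) / real (binomial_le n R)))"
      using assms by (intro normal_density_le) auto
    also have "cov_density n R * (real (binomial_le (Suc n) R) / real (binomial_le n R))
        \<le> c * (real (binomial_le (Suc n) R) / real (binomial_le n R))"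
      using elim(3) by (rule mult_right_mono) simp
    also have "\<dots> \<le> ?T" using elim(1) by simp
    finally show ?case by simp
  qed
  then have "\<forall>\<^sub>F n in sequentially. normal_density n R \<le> ereal ?T"
    by (rule eventually_sequentially_Suc[THEN iffD1])
  then show ?thesis unfolding normal_density_limsup_def by (rule Limsup_bounded)
qed

end
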